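(* Let $m\ge 1$, let $\alpha_1,\ldots,\alpha_m$ be distinct algebraic numbers and let $\beta_1,\ldots,\beta_m$ be nonzero algebraic numbers. Let $d$ be the maximal degree (over $\mathbb{Q}$) and $h$ the maximal Weil height of the numbers $\alpha_1,\ldots,\alpha_m,\beta_1,\ldots,\beta_m$. Then $$\log\left|\beta_1 e^{\alpha_1}+\cdots+\beta_m e^{\alpha_m}\right| \;\ge\; -e^{8\delta\mu} - r\, m^{\delta} e^{6\delta^2\mu}\Big(mh+\tfrac{39}{164}\mu+e^{R}\Big),$$ where - $\delta=d^{2m}$, - $\mu=m d^{6m}\left(\tfrac{2h}{d}+3\right)$, - $R=r' m^{\delta}e^{6\delta^2\mu}+r'' m^{\delta}e^{6\delta^2\mu}\,(\log m+6\delta\mu)+72\,e^{2\delta\mu}$, - $r=82\left(\tfrac92\right)^{\delta}\delta^{3\delta+2}$, - $r'=12\left(\tfrac92\right)^{\delta}\delta^{3\delta+2}+16(1+6\delta^2)\left(\tfrac92\right)^{\delta}\delta^{3\delta}\log(9\delta^3)+80\left(\tfrac92\right)^{\delta}\delta^{3\delta+4}(1+6\delta)\mu$, - $r''=16(1+6\delta^2)\left(\tfrac92\right)^{\delta}\delta^{3\delta}$.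
   Context: $\log$ denotes the natural logarithm. Algebraic numbers are complex numbers algebraic over $\mathbb{Q}$. The Weil height is the absolute logarithmic height: for an algebraic number $\alpha$ of degree $n$ whose defining polynomial (the integer polynomial of least degree with coprime coefficients vanishing at $\alpha$) is $a_n\prod_{i=1}^n(x-\alpha^{(i)})$, it equals $\frac1n\log\big(|a_n|\prod_{i=1}^n\max\{1,|\alpha^{(i)}|\}\big)$. *)

theory Defs
  imports "HOL-Computational_Algebra.Computational_Algebra"
begin

text \<open>
  The conditions below determine the polynomial only up to sign, so one of the two is chosen.
  Coprimality of the coefficients is expressed by the content being 1, which excludes the zero
  polynomial. If the argument is not algebraic, the result is unspecified.
\<close>

definition defining_poly :: "complex \<Rightarrow> int poly" where
  "defining_poly \<alpha> = (ARG_MIN degree p. content p = 1 \<and> poly (map_poly of_int p) \<alpha> = 0)"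

definition alg_degree :: "complex \<Rightarrow> nat" where
  "alg_degree \<alpha> = degree (defining_poly \<alpha>)"

definition weil_height :: "complex \<Rightarrow> real" where
  "weil_height \<alpha> =
     ln (real_of_int \<bar>lead_coeff (defining_poly \<alpha>)\<bar> *
         (\<Prod>z\<in>#proots (map_poly of_int (defining_poly \<alpha>) :: complex poly). max 1 (norm z)))
     / real (alg_degree \<alpha>)"

end

theory Submission
  imports
    Defs
    "Jordan_Normal_Form.Char_Poly"
    "HOL-Computational_Algebra.Field_as_Ring"
begin

text \<open>
  The proof combines Hermite's simultaneous approximations with Siegel's method of enlarging a linear
  relation; it needs neither Galois closures nor auxiliary primes.
  Let \<open>B k\<close> be the set of all \<open>\<Sum> n i * \<alpha> i\<close> with \<open>n i \<le> k\<close>, and put \<open>\<Lambda> = \<Sum> \<beta> i * exp (\<alpha> i)\<close>. Multiplying \<open>\<Lambda>\<close> by \<open>exp s\<close>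
  for \<open>s \<in> B k\<close> gives \<open>card (B k)\<close> linearly independent linear forms in the exponentials \<open>exp \<gamma>\<close>,
  \<open>\<gamma> \<in> B (k + 1)\<close>. As \<open>card (B k)\<close> grows only polynomially in \<open>k\<close>, some \<open>k\<close> makes \<open>card (B (k + 1))\<close> very
  close to \<open>card (B k)\<close>.
  Evaluating the forms at the Hermite approximations \<open>\<Sum>r. f\<^sup>(\<^sup>r\<^sup>) \<gamma>\<close> of \<open>exp \<gamma>\<close>, where
  \<open>f = x ^ j * (\<Prod>\<gamma>. x - \<gamma>) ^ n\<close>, gives a matrix with a nonzero maximal minor. This minor is an integer
  polynomial in the \<open>\<alpha> i\<close> and \<open>\<beta> i\<close>; it is small if \<open>\<Lambda>\<close> is, and because the matrix is close to a matrix of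
  rank one, it is not too large when the \<open>\<alpha> i\<close> and \<open>\<beta> i\<close> are replaced by arbitrary conjugates.
  Multiplying its nonzero values over all choices of conjugates yields a nonzero integer, which bounds
  \<open>\<Lambda>\<close> from below.
\<close>

text \<open>Write N for \<open>fact n\<close>. Up to factors exponential in n, a matrix entry can be
  as large as w!/N, about N^(M-1), while its approximation error is only of size 1/N. Estimating the
  minor entry by entry would cost a power N^(M'(M-1)) at each tuple, which nothing could compensate.
  Since the main part has rank one, w! enters the determinant only once: the minor is at most about
  N^(M-M') at every tuple, and about N^(-M') at the identity tuple if \<Lambda> is tiny. With
  \<delta> tuples this contradicts integrality as soon as (\<delta>-1)(M-M') is at most M'/2; hence
  the search for consecutive sets of almost equal size. Nonvanishing of the minor has to be secured
  only at the identity tuple. At other tuples the minor may vanish, and these drop out of the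
  product; this is why arbitrary choices of conjugates suffice. The outcome is |\<Lambda>| \<ge>
  1/w!, and the double exponential exp R of the theorem absorbs ln (w!).\<close>

hide_const (open) module.smult

section \<open>Conjugates and heights\<close>

text \<open>The minimum is meaningful only if some polynomial qualifies; the primitive part of any
  nonzero integer polynomial vanishing at \<open>x\<close> does.\<close>

lemma defining_poly_content_root:
  assumes "algebraic x"
  shows "content (defining_poly x) = 1"
    and "poly (map_poly of_int (defining_poly x)) x = 0"
proof -
  obtain p :: "complex poly" where p: "\<And>i. coeff p i \<in> \<int>" "p \<noteq> 0" "poly p x = 0"
    using assms unfolding algebraic_def by blast
  obtain q where q: "p = map_poly of_int q"
    using intpolyE p(1) by blast
  have "q \<noteq> 0" using p(2) q by auto
  have eq: "p = smult (of_int (content q)) (map_poly of_int (primitive_part q))"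
    unfolding q by (subst content_times_primitive_part[of q, symmetric])
      (simp only: of_int_hom.map_poly_hom_smult)
  have "poly (map_poly of_int (primitive_part q)) x = 0"
    using p(3) \<open>q \<noteq> 0\<close> by (subst (asm) eq) auto
  then have ex: "content (primitive_part q) = 1 \<and> poly (map_poly of_int (primitive_part q)) x = 0"
    using \<open>q \<noteq> 0\<close> by simp
  then have "content (defining_poly x) = 1 \<and> poly (map_poly of_int (defining_poly x)) x = 0"
    unfolding defining_poly_def
    by (rule arg_min_natI[where P = "\<lambda>p. content p = 1 \<and> poly (map_poly of_int p) x = 0"])
  then show "content (defining_poly x) = 1" "poly (map_poly of_int (defining_poly x)) x = 0"
    by auto
qed

lemma defining_poly_nonzero: "algebraic x \<Longrightarrow> defining_poly x \<noteq> 0"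
  using defining_poly_content_root(1) by fastforce

text \<open>Minimality is built in for primitive polynomials only; passing to the primitive part
  keeps the degree and the root.\<close>

lemma alg_degree_le:
  assumes "q \<noteq> 0" "poly (map_poly of_int q) x = 0"
  shows "alg_degree x \<le> degree q"
proof -
  have "poly (map_poly of_int (smult (content q) (primitive_part q))) x = 0"
    using assms(2) by simp
  then have "poly (map_poly of_int (primitive_part q)) x = 0"
    using assms(1) by (simp only: of_int_hom.map_poly_hom_smult) auto
  then have "degree (defining_poly x) \<le> degree (primitive_part q)"
    unfolding defining_poly_def using assms(1)
    by (intro arg_min_nat_le[where P = "\<lambda>p. content p = 1 \<and> poly (map_poly of_int p) x = 0"]) auto
  then show ?thesis by (simp add: alg_degree_def)
qed

lemma alg_degree_pos:
  assumes "algebraic x"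
  shows "alg_degree x > 0"
proof (rule ccontr)
  assume "\<not> ?thesis"
  then obtain c where c: "defining_poly x = [:c:]"
    by (metis alg_degree_def degree_0_id neq0_conv)
  then show False
    using defining_poly_content_root(2)[OF assms] defining_poly_nonzero[OF assms] by simp
qed

text \<open>Minimality of degree replaces irreducibility. At a double root \<open>z\<close>, the
  derivative shows that a minimal integer polynomial \<open>r\<close> of \<open>z\<close> has
  smaller degree than \<open>p\<close>. Pseudo-division gives c p = r q, so \<open>x\<close> is a
  root of \<open>r\<close> or \<open>q\<close>, both of degree below that of
  \<open>p\<close>.\<close>

lemma rsquarefree_defining_poly:
  assumes "algebraic x"
  shows "rsquarefree (map_poly of_int (defining_poly x) :: complex poly)"
  unfolding rsquarefree_roots
proof (intro allI notI, elim conjE)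
  define p where "p = defining_poly x"
  have p: "p \<noteq> 0" "poly (map_poly of_int p) x = 0" "degree p > 0"
    "\<And>q. q \<noteq> 0 \<Longrightarrow> poly (map_poly of_int q) x = 0 \<Longrightarrow> degree p \<le> degree q"
    using defining_poly_nonzero[OF assms] defining_poly_content_root(2)[OF assms]
      alg_degree_pos[OF assms] alg_degree_le by (auto simp: p_def alg_degree_def)
  fix z :: complex
  assume z: "poly (map_poly of_int (defining_poly x)) z = 0"
    "poly (pderiv (map_poly of_int (defining_poly x))) z = 0"
  define P where "P = (\<lambda>q :: int poly. q \<noteq> 0 \<and> poly (map_poly of_int q) z = 0)"
  define r where "r = (ARG_MIN degree q. P q)"
  have "P p" using p z by (simp add: P_def p_def)
  then have "P r" unfolding r_def by (rule arg_min_natI)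
  then have r: "r \<noteq> 0" "poly (map_poly of_int r) z = 0" by (auto simp: P_def)
  have r_min: "P q \<Longrightarrow> degree r \<le> degree q" for q
    unfolding r_def by (rule arg_min_nat_le)
  have deg_r: "degree r > 0"
  proof (rule ccontr)
    assume "\<not> ?thesis"
    then obtain c where "r = [:c:]" by (metis degree_0_id neq0_conv)
    with r show False by simp
  qed
  have "P (pderiv p)"
    using z p(3) by (auto simp: P_def p_def of_int_hom.map_poly_pderiv pderiv_eq_0_iff)
  then have deg_r_less: "degree r < degree p"
    using r_min[of "pderiv p"] p(3) by (simp add: degree_pderiv)
  obtain q s where qs: "pseudo_divmod p r = (q, s)" by fastforce
  define c where "c = lead_coeff r ^ (Suc (degree p) - degree r)"
  have c: "c \<noteq> 0" using r by (simp add: c_def)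
  have eq: "smult c p = r * q + s" and deg_s: "s = 0 \<or> degree s < degree r"
    using pseudo_divmod[OF r(1) qs] by (auto simp: c_def)
  have "poly (map_poly of_int (smult c p)) z = 0"
    using z(1) by (simp add: p_def of_int_hom.map_poly_hom_smult)
  then have "poly (map_poly of_int s) z = 0"
    unfolding eq using r(2) by (simp add: of_int_poly_hom.hom_add of_int_poly_hom.hom_mult)
  then have "s = 0"
    using r_min[of s] deg_s by (force simp: P_def)
  then have eq: "smult c p = r * q" using eq by simp
  then have "q \<noteq> 0" using c p(1) by auto
  have "degree p = degree r + degree q"
    using arg_cong[OF eq, of degree] c r(1) \<open>q \<noteq> 0\<close> by (simp add: degree_mult_eq)
  moreover have "poly (map_poly of_int (smult c p)) x = 0"
    using p(2) by (simp add: of_int_hom.map_poly_hom_smult)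
  then have "poly (map_poly of_int r) x = 0 \<or> poly (map_poly of_int q) x = 0"
    unfolding eq by (simp add: of_int_poly_hom.hom_mult)
  ultimately show False
    using p(4)[of r] p(4)[of q] r(1) \<open>q \<noteq> 0\<close> deg_r deg_r_less by linarith
qed

definition alg_conjs :: "complex \<Rightarrow> complex set" where
  "alg_conjs x = {z. poly (map_poly of_int (defining_poly x)) z = 0}"

lemma self_in_alg_conjs: "algebraic x \<Longrightarrow> x \<in> alg_conjs x"
  using defining_poly_content_root(2) by (simp add: alg_conjs_def)

lemma finite_alg_conjs: "algebraic x \<Longrightarrow> finite (alg_conjs x)"
  using defining_poly_nonzero by (simp add: alg_conjs_def poly_roots_finite)

lemma card_alg_conjs:
  assumes "algebraic x"
  shows "card (alg_conjs x) = alg_degree x"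
proof -
  define p where "p = (map_poly of_int (defining_poly x) :: complex poly)"
  have "p \<noteq> 0" using defining_poly_nonzero[OF assms] by (simp add: p_def)
  then have "card {z. poly p z = 0} = degree p"
    using rsquarefree_card_degree[of p] rsquarefree_defining_poly[OF assms] by (simp add: p_def)
  then show ?thesis by (simp add: p_def alg_conjs_def alg_degree_def)
qed

text \<open>The Mahler measure is the exponential of degree times height. It is a product of factors
  that are at least 1, so it bounds the leading coefficient and every root.\<close>

lemma
  assumes x: "algebraic x" and "alg_degree x \<le> d" "weil_height x \<le> h"
  shows weil_height_nonneg: "weil_height x \<ge> 0"
    and lead_coeff_le_height: "real_of_int \<bar>lead_coeff (defining_poly x)\<bar> \<le> exp (real d * h)"
    and conj_le_height: "z \<in> alg_conjs x \<Longrightarrow> norm z \<le> exp (real d * h)"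
proof -
  define p where "p = (map_poly of_int (defining_poly x) :: complex poly)"
  define l where "l = real_of_int \<bar>lead_coeff (defining_poly x)\<bar>"
  define P where "P = (\<Prod>z\<in>#proots p. max 1 (norm z))"
  have p0: "p \<noteq> 0" using defining_poly_nonzero[OF x] by (simp add: p_def)
  have "\<bar>lead_coeff (defining_poly x)\<bar> \<ge> 1"
    using leading_coeff_neq_0[OF defining_poly_nonzero[OF x]] by linarith
  then have l: "l \<ge> 1" unfolding l_def by (simp only: of_int_1_le_iff)
  have ge1: "(\<Prod>z\<in>#A. max 1 (norm z)) \<ge> 1" for A :: "complex multiset"
  proof (induction A)
    case (add a A)
    have "1 * 1 \<le> max 1 (norm a) * (\<Prod>z\<in>#A. max 1 (norm z))"
      using add by (intro mult_mono) auto
    then show ?case by simp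
  qed auto
  have P: "P \<ge> 1" by (simp add: P_def ge1)
  have h: "weil_height x = ln (l * P) / real (alg_degree x)"
    by (simp add: weil_height_def l_def P_def p_def)
  have lP: "l * P \<ge> 1" using l P by (smt (verit) mult_le_cancel_left1)
  show nonneg: "weil_height x \<ge> 0" using lP by (simp add: h)
  have "ln (l * P) = weil_height x * alg_degree x"
    using alg_degree_pos[OF x] by (simp add: h)
  also have "\<dots> \<le> h * d" using assms nonneg by (intro mult_mono) auto
  finally have "l * P \<le> exp (real d * h)" using lP by (subst ln_le_cancel_iff[symmetric]) (simp_all add: mult.commute)
  moreover have "l * 1 \<le> l * P" "1 * P \<le> l * P" using l P by (auto intro!: mult_mono)
  ultimately have *: "l \<le> exp (real d * h)" "P \<le> exp (real d * h)" by linarith+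
  show "real_of_int \<bar>lead_coeff (defining_poly x)\<bar> \<le> exp (real d * h)"
    using * by (simp add: l_def)
  show "norm z \<le> exp (real d * h)" if "z \<in> alg_conjs x"
  proof -
    have "z \<in># proots p" using that p0 by (simp add: alg_conjs_def p_def)
    then obtain A where A: "proots p = add_mset z A" by (meson multi_member_split)
    have "norm z * 1 \<le> max 1 (norm z) * (\<Prod>z\<in>#A. max 1 (norm z))"
      using ge1 by (intro mult_mono) auto
    also have "\<dots> = P" by (simp add: P_def A)
    finally show ?thesis using * by simp
  qed
qed

section \<open>Liouville's inequality over tuples of conjugates\<close>

text \<open>For each \<open>t\<close>, the vector of all \<open>m e t\<close> is an eigenvector of
  the integer matrix \<open>B\<close> with eigenvalue \<open>F t\<close>. The matrix
  \<open>X\<close> inverts the matrix of these vectors, so \<open>B\<close> is similar to a diagonal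
  matrix and the product is its characteristic polynomial.\<close>

lemma int_poly_prod_diag:
  fixes m :: "'e \<Rightarrow> 't \<Rightarrow> complex" and B :: "'e \<Rightarrow> 'e \<Rightarrow> int"
  assumes fin: "finite T" "finite E" and card: "card T = card E"
    and X: "\<And>t t'. t \<in> T \<Longrightarrow> t' \<in> T \<Longrightarrow> (\<Sum>e\<in>E. X t e * m e t') = (if t = t' then 1 else 0)"
    and B: "\<And>e t. e \<in> E \<Longrightarrow> t \<in> T \<Longrightarrow> F t * m e t = (\<Sum>e'\<in>E. of_int (B e e') * m e' t)"
  shows "\<exists>p :: int poly. map_poly of_int p = (\<Prod>t\<in>T. [:- F t, 1:])"
proof -
  define N where "N = card T"
  obtain t where t: "bij_betw t {..<N} T"
    using ex_bij_betw_nat_finite[OF fin(1)] by (auto simp: N_def lessThan_atLeast0)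
  obtain e where e: "bij_betw e {..<N} E"
    using ex_bij_betw_nat_finite[OF fin(2)] by (auto simp: N_def card lessThan_atLeast0)
  have tT: "t i \<in> T" if "i < N" for i using t that by (auto simp: bij_betw_def)
  have eE: "e i \<in> E" if "i < N" for i using e that by (auto simp: bij_betw_def)
  have t_eq: "t i = t j \<longleftrightarrow> i = j" if "i < N" "j < N" for i j
    using t that by (auto simp: bij_betw_def inj_on_def)
  have sum_e: "(\<Sum>i<N. f (e i)) = (\<Sum>x\<in>E. f x)" for f :: "_ \<Rightarrow> complex"
    by (rule sum.reindex_bij_betw[OF e])
  define P where "P = mat N N (\<lambda>(i, j). X (t i) (e j))"
  define Q where "Q = mat N N (\<lambda>(i, j). m (e i) (t j))"
  define D where "D = mat N N (\<lambda>(i, j). if i = j then F (t i) else 0)"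
  define Z where "Z = mat N N (\<lambda>(i, j). B (e i) (e j))"
  define C where "C = map_mat (of_int :: int \<Rightarrow> complex) Z"
  have carr: "P \<in> carrier_mat N N" "Q \<in> carrier_mat N N" "D \<in> carrier_mat N N"
    "Z \<in> carrier_mat N N" "C \<in> carrier_mat N N"
    by (auto simp: P_def Q_def D_def Z_def C_def)
  have PQ: "P * Q = 1\<^sub>m N"
  proof (rule eq_matI)
    fix i j assume "i < dim_row (1\<^sub>m N :: complex mat)" "j < dim_col (1\<^sub>m N :: complex mat)"
    then have ij: "i < N" "j < N" by auto
    have "(P * Q) $$ (i, j) = (\<Sum>k<N. X (t i) (e k) * m (e k) (t j))"
      using ij by (simp add: P_def Q_def scalar_prod_def lessThan_atLeast0)
    also have "\<dots> = (\<Sum>x\<in>E. X (t i) x * m x (t j))" by (rule sum_e)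
    also have "\<dots> = 1\<^sub>m N $$ (i, j)" using ij by (simp add: X tT t_eq)
    finally show "(P * Q) $$ (i, j) = 1\<^sub>m N $$ (i, j)" .
  qed (auto simp: P_def Q_def)
  have QP: "Q * P = 1\<^sub>m N"
    by (rule mat_mult_left_right_inverse[OF carr(1,2) PQ])
  have QD: "Q * D = C * Q"
  proof (rule eq_matI)
    fix i j assume "i < dim_row (C * Q)" "j < dim_col (C * Q)"
    then have ij: "i < N" "j < N" using carr by auto
    have "(Q * D) $$ (i, j) = (\<Sum>k<N. m (e i) (t k) * (if k = j then F (t k) else 0))"
      using ij by (simp add: Q_def D_def scalar_prod_def lessThan_atLeast0)
    also have "\<dots> = F (t j) * m (e i) (t j)"
      using ij by (subst sum.remove[of _ j]) (auto intro!: sum.neutral)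
    also have "\<dots> = (\<Sum>x\<in>E. of_int (B (e i) x) * m x (t j))"
      using ij by (intro B eE tT)
    also have "\<dots> = (\<Sum>k<N. of_int (B (e i) (e k)) * m (e k) (t j))" by (rule sum_e[symmetric])
    also have "\<dots> = (C * Q) $$ (i, j)"
      using ij by (simp add: C_def Z_def Q_def scalar_prod_def lessThan_atLeast0)
    finally show "(Q * D) $$ (i, j) = (C * Q) $$ (i, j)" .
  qed (auto simp: Q_def D_def C_def Z_def)
  have "D = (P * Q) * D" using carr by (simp add: PQ)
  also have "\<dots> = P * (C * Q)" using assoc_mult_mat[OF carr(1,2,3)] QD by simp
  also have "\<dots> = P * C * Q" using assoc_mult_mat[OF carr(1,5,2)] by simp
  finally have "similar_mat D C"
    using similar_matI[of D C P Q N] carr PQ QP by blast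
  then have "char_poly C = char_poly D" using char_poly_similar by metis
  also have "\<dots> = (\<Prod>a\<leftarrow>diag_mat D. [:- a, 1:])"
    by (rule char_poly_upper_triangular[OF carr(3)]) (auto simp: D_def)
  also have "\<dots> = (\<Prod>i<N. [:- F (t i), 1:])"
    by (simp add: diag_mat_def D_def prod.distinct_set_conv_list lessThan_atLeast0
        cong: map_cong) (simp add: comp_def D_def prod.list_conv_set_nth lessThan_atLeast0 )
  also have "\<dots> = (\<Prod>x\<in>T. [:- F x, 1:])" by (rule prod.reindex_bij_betw[OF t])
  finally have "(\<Prod>x\<in>T. [:- F x, 1:]) = char_poly C" ..
  also have "\<dots> = map_poly of_int (char_poly Z)"
    unfolding C_def by (rule of_int_hom.char_poly_hom[OF carr(4)])
  finally show ?thesis by metis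
qed

text \<open>The zero eigenvalues contribute a power of the variable. The lowest nonzero coefficient
  is therefore, up to sign, the product of the nonzero values, and it is an integer.\<close>

lemma prod_nonzero_ge_1:
  fixes F :: "'t \<Rightarrow> complex" and p :: "int poly"
  assumes fin: "finite T" and p: "map_poly of_int p = (\<Prod>t\<in>T. [:- F t, 1:])"
  shows "1 \<le> (\<Prod>t\<in>{t\<in>T. F t \<noteq> 0}. norm (F t))"
proof -
  define S where "S = {t \<in> T. F t \<noteq> 0}"
  define k where "k = card (T - S)"
  have S: "finite S" "S \<subseteq> T" "T = (T - S) \<union> S" using fin by (auto simp: S_def)
  have "(\<Prod>t\<in>T. [:- F t, 1:]) = (\<Prod>t\<in>T - S. [:- F t, 1:]) * (\<Prod>t\<in>S. [:- F t, 1:])"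
    by (subst S(3), rule prod.union_disjoint) (use fin S in auto)
  also have "(\<Prod>t\<in>T - S. [:- F t, 1:]) = (\<Prod>t\<in>T - S. [:0, 1:])"
    by (rule prod.cong) (auto simp: S_def)
  also have "\<dots> = monom 1 k" by (simp add: k_def monom_altdef)
  finally have "coeff (map_poly of_int p) k = coeff (\<Prod>t\<in>S. [:- F t, 1:]) 0"
    unfolding p by (simp add: coeff_monom_mult)
  also have "\<dots> = (\<Prod>t\<in>S. - F t)"
    by (simp add: poly_0_coeff_0[symmetric] poly_prod)
  finally have eq: "of_int (coeff p k) = (\<Prod>t\<in>S. - F t)" by simp
  have "(\<Prod>t\<in>S. - F t) \<noteq> 0" using S(1) by (auto simp: S_def)
  then have "coeff p k \<noteq> 0" using eq by auto
  then have "1 \<le> \<bar>coeff p k\<bar>" by linarith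
  then have "1 \<le> norm (of_int (coeff p k) :: complex)"
    by (metis norm_of_int of_int_1_le_iff of_int_abs)
  also have "\<dots> = (\<Prod>t\<in>S. norm (F t))"
    unfolding eq by (simp add: prod_norm[symmetric])
  finally show ?thesis by (simp add: S_def)
qed

text \<open>
  A tuple picks a conjugate of every element of \<open>V\<close>, independently of each other; it need not come from
  a field embedding. The values of an element of \<open>int_funs V\<close> at the tuples are the eigenvalues of an
  integer matrix, which replaces the norm of the number field generated by \<open>V\<close>.
\<close>

definition conj_tuples :: "complex set \<Rightarrow> (complex \<Rightarrow> complex) set" where
  "conj_tuples V = PiE V alg_conjs"

inductive_set int_funs :: "complex set \<Rightarrow> ((complex \<Rightarrow> complex) \<Rightarrow> complex) set"
  for V where
  of_int: "(\<lambda>_. of_int k) \<in> int_funs V"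
| var: "x \<in> V \<Longrightarrow> (\<lambda>t. of_int (lead_coeff (defining_poly x)) * t x) \<in> int_funs V"
| add: "F \<in> int_funs V \<Longrightarrow> G \<in> int_funs V \<Longrightarrow> (\<lambda>t. F t + G t) \<in> int_funs V"
| mult: "F \<in> int_funs V \<Longrightarrow> G \<in> int_funs V \<Longrightarrow> (\<lambda>t. F t * G t) \<in> int_funs V"

text \<open>Multiplying the equation of \<open>z\<close> by l^(D-1), D its degree, makes
  \<open>l * z\<close> a root of a monic integer polynomial. The coefficients must be common to all
  conjugates, because they become entries of a single matrix valid at every tuple.\<close>

lemma scaled_conj_power_reduce:
  assumes x: "algebraic x" and k: "k < alg_degree x"
  defines "l \<equiv> lead_coeff (defining_poly x)"
  shows "\<exists>c :: nat \<Rightarrow> int. \<forall>z\<in>alg_conjs x.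
           (of_int l * z) ^ Suc k = (\<Sum>j<alg_degree x. of_int (c j) * (of_int l * z) ^ j)"
proof (cases "Suc k < alg_degree x")
  case True
  have "(of_int l * z) ^ Suc k =
      (\<Sum>j<alg_degree x. of_int (if j = Suc k then 1 else 0) * (of_int l * z) ^ j)" for z :: complex
    using True by (subst sum.remove[of _ "Suc k"]) (auto intro!: sum.neutral)
  then show ?thesis by (intro exI[of _ "\<lambda>j. if j = Suc k then 1 else 0"] ballI)
next
  case False
  define p where "p = defining_poly x"
  define D where "D = alg_degree x"
  have D: "Suc k = D" "degree p = D" "coeff p D = l" "D > 0"
    using False k by (auto simp: D_def p_def alg_degree_def l_def)
  have "(of_int l * z) ^ Suc k = (\<Sum>j<D. of_int (- coeff p j * l ^ (D - 1 - j)) * (of_int l * z) ^ j)"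
    if "z \<in> alg_conjs x" for z
  proof -
    have "0 = (\<Sum>j\<le>D. of_int (coeff p j) * z ^ j)"
      using that by (simp add: alg_conjs_def poly_altdef p_def[symmetric] D)
    also have "\<dots> = of_int l * z ^ D + (\<Sum>j<D. of_int (coeff p j) * z ^ j)"
      using D by (simp add: lessThan_Suc_atMost[symmetric])
    finally have "of_int l * z ^ D = - (\<Sum>j<D. of_int (coeff p j) * z ^ j)"
      by (simp add: eq_neg_iff_add_eq_0)
    then have "of_int l ^ (D - 1) * (of_int l * z ^ D) =
        (\<Sum>j<D. of_int l ^ (D - 1) * - (of_int (coeff p j) * z ^ j))"
      by (simp add: sum_negf sum_distrib_left)
    moreover have "of_int l ^ (D - 1) * (of_int l * z ^ D) = (of_int l * z) ^ D"
      using D by (cases D) (auto simp: power_mult_distrib)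
    moreover have "of_int l ^ (D - 1) * - (of_int (coeff p j) * z ^ j) =
        of_int (- coeff p j * l ^ (D - 1 - j)) * (of_int l * z) ^ j" if "j < D" for j
    proof -
      have "D - 1 = (D - 1 - j) + j" using that by simp
      then have "(of_int l :: complex) ^ (D - 1) = of_int l ^ (D - 1 - j) * of_int l ^ j"
        by (metis power_add)
      then show ?thesis by (simp add: power_mult_distrib)
    qed
    ultimately have "(of_int l * z) ^ D =
        (\<Sum>j<D. of_int (- coeff p j * l ^ (D - 1 - j)) * (of_int l * z) ^ j)"
      by (metis (no_types, lifting) lessThan_iff sum.cong)
    then show ?thesis by (simp only: D(1))
  qed
  then show ?thesis unfolding D_def
    by (intro exI[of _ "\<lambda>j. - coeff p j * l ^ (alg_degree x - 1 - j)"] ballI)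
qed

text \<open>The coefficients of the Lagrange polynomials invert the Vandermonde matrix of the scaled
  conjugates.\<close>

lemma lagrange_on_scaled_conjs:
  assumes x: "algebraic x" and a: "a \<in> alg_conjs x" and l: "l \<noteq> 0"
  shows "\<exists>c :: nat \<Rightarrow> complex. \<forall>b\<in>alg_conjs x.
           (\<Sum>j<alg_degree x. c j * (l * b) ^ j) = (if a = b then 1 else 0)"
proof -
  define R where "R = alg_conjs x - {a}"
  have R: "finite R" "card R = alg_degree x - 1"
    using a finite_alg_conjs[OF x] card_alg_conjs[OF x] by (auto simp: R_def)
  define L where "L = (\<Prod>b\<in>R. smult (1 / (l * a - l * b)) [:- (l * b), 1:])"
  have "degree L \<le> (\<Sum>b\<in>R. degree (smult (1 / (l * a - l * b)) [:- (l * b), 1:]))"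
    unfolding L_def by (rule order_trans[OF degree_prod_sum_le[OF R(1)]]) (simp only: comp_def order_refl)
  also have "\<dots> \<le> (\<Sum>b\<in>R. 1)"
    by (rule sum_mono) (auto intro: order_trans[OF degree_smult_le])
  finally have deg: "degree L < alg_degree x"
    using R alg_degree_pos[OF x] by simp
  have "(\<Sum>j<alg_degree x. coeff L j * (l * b) ^ j) = (if a = b then 1 else 0)"
    if b: "b \<in> alg_conjs x" for b
  proof -
    have "(\<Sum>j<alg_degree x. coeff L j * (l * b) ^ j) = poly L (l * b)"
      unfolding poly_altdef using deg
      by (intro sum.mono_neutral_right) (auto simp: coeff_eq_0 not_less)
    also have "\<dots> = (\<Prod>c\<in>R. (l * b - l * c) / (l * a - l * c))"
      by (simp add: L_def poly_prod diff_divide_distrib)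
    also have "\<dots> = (if a = b then 1 else 0)"
    proof (cases "a = b")
      case True
      then show ?thesis using l by (intro trans[OF prod.neutral]) (auto simp: R_def)
    next
      case False
      then have "b \<in> R" using b by (simp add: R_def)
      then show ?thesis using R False by (auto intro!: prod_zero)
    qed
    finally show ?thesis .
  qed
  then show ?thesis by blast
qed

text \<open>The matrix describes multiplication by \<open>F\<close> on the integer span of the
  monomials \<open>m e\<close>, whose exponents stay below the degrees. There are as many of them as
  tuples.\<close>

theorem int_fun_liouville:
  assumes V: "finite V" "\<And>x. x \<in> V \<Longrightarrow> algebraic x" and F: "F \<in> int_funs V"
  shows "1 \<le> (\<Prod>t\<in>{t \<in> conj_tuples V. F t \<noteq> 0}. norm (F t))"
proof -
  define T where "T = conj_tuples V"
  define E where "E = PiE V (\<lambda>x. {..<alg_degree x})"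
  define l where "l = (\<lambda>x. lead_coeff (defining_poly x))"
  define m :: "(complex \<Rightarrow> nat) \<Rightarrow> (complex \<Rightarrow> complex) \<Rightarrow> complex"
    where "m = (\<lambda>e t. \<Prod>x\<in>V. (of_int (l x) * t x) ^ e x)"
  have fin: "finite T" "finite E"
    using V finite_alg_conjs by (auto simp: T_def E_def conj_tuples_def intro!: finite_PiE)
  have card: "card T = card E"
    using V by (simp add: T_def E_def conj_tuples_def card_PiE card_alg_conjs)
  have TD: "t x \<in> alg_conjs x" if "t \<in> T" "x \<in> V" for t x
    using that by (auto simp: T_def conj_tuples_def)
  have ED: "e x < alg_degree x" if "e \<in> E" "x \<in> V" for e x
    using that by (auto simp: E_def)
  have "\<exists>c. \<forall>b\<in>alg_conjs x. (\<Sum>j<alg_degree x. c j * (of_int (l x) * b) ^ j) = (if a = b then 1 else 0)"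
    if "x \<in> V" "a \<in> alg_conjs x" for x a
    using that V defining_poly_nonzero by (intro lagrange_on_scaled_conjs) (auto simp: l_def)
  then obtain c where c: "(\<Sum>j<alg_degree x. c x a j * (of_int (l x) * b) ^ j) = (if a = b then 1 else 0)"
    if "x \<in> V" "a \<in> alg_conjs x" "b \<in> alg_conjs x" for x a b
    by metis
  \<comment> \<open>Tensor product of the interpolations in the single coordinates;
    \<open>prod_sum_PiE\<close> then factors the sum over \<open>E\<close>.\<close>
  define X where "X = (\<lambda>t e. \<Prod>x\<in>V. c x (t x) (e x))"
  have X: "(\<Sum>e\<in>E. X t e * m e t') = (if t = t' then 1 else 0)" if t: "t \<in> T" "t' \<in> T" for t t'
  proof -
    have "(\<Sum>e\<in>E. X t e * m e t') = (\<Sum>e\<in>E. \<Prod>x\<in>V. c x (t x) (e x) * (of_int (l x) * t' x) ^ e x)"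
      by (simp add: X_def m_def prod.distrib)
    also have "\<dots> = (\<Prod>x\<in>V. \<Sum>j<alg_degree x. c x (t x) j * (of_int (l x) * t' x) ^ j)"
      unfolding E_def using V by (subst prod_sum_PiE) auto
    also have "\<dots> = (\<Prod>x\<in>V. if t x = t' x then 1 else 0)"
      using t by (intro prod.cong refl c TD)
    also have "\<dots> = (if t = t' then 1 else 0)"
    proof (cases "t = t'")
      case False
      then obtain x where "x \<in> V" "t x \<noteq> t' x"
        using t unfolding T_def conj_tuples_def by (metis PiE_ext)
      then show ?thesis using V False by (auto intro!: prod_zero)
    qed auto
    finally show ?thesis .
  qed
  \<comment> \<open>Agreement is demanded on \<open>T\<close> only, since high powers reduce only at
    conjugates.\<close>
  define Z where "Z = (\<lambda>G. \<exists>b :: (complex \<Rightarrow> nat) \<Rightarrow> int. \<forall>t\<in>T. G t = (\<Sum>e\<in>E. of_int (b e) * m e t))"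
  have Z_m: "Z (m e)" if "e \<in> E" for e
    unfolding Z_def
  proof (intro exI ballI)
    fix t
    show "m e t = (\<Sum>e'\<in>E. of_int (if e' = e then 1 else 0) * m e' t)"
      using fin that by (subst sum.remove[of _ e]) (auto intro!: sum.neutral)
  qed
  have Z_add: "Z (\<lambda>t. G t + H t)" if G: "Z G" and H: "Z H" for G H
  proof -
    obtain b :: "(complex \<Rightarrow> nat) \<Rightarrow> int" where "\<forall>t\<in>T. G t = (\<Sum>e\<in>E. of_int (b e) * m e t)"
      using G unfolding Z_def by blast
    moreover obtain b' :: "(complex \<Rightarrow> nat) \<Rightarrow> int" where "\<forall>t\<in>T. H t = (\<Sum>e\<in>E. of_int (b' e) * m e t)"
      using H unfolding Z_def by blast
    ultimately have "\<forall>t\<in>T. G t + H t = (\<Sum>e\<in>E. of_int (b e + b' e) * m e t)"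
      by (simp add: sum.distrib ring_distribs)
    then show ?thesis unfolding Z_def by (intro exI[of _ "\<lambda>e. b e + b' e"])
  qed
  have Z_cmult: "Z (\<lambda>t. of_int k * G t)" if G: "Z G" for G k
  proof -
    obtain b :: "(complex \<Rightarrow> nat) \<Rightarrow> int" where "\<forall>t\<in>T. G t = (\<Sum>e\<in>E. of_int (b e) * m e t)"
      using G unfolding Z_def by blast
    then have "\<forall>t\<in>T. of_int k * G t = (\<Sum>e\<in>E. of_int (k * b e) * m e t)"
      by (simp add: sum_distrib_left mult.assoc)
    then show ?thesis unfolding Z_def by (intro exI[of _ "\<lambda>e. k * b e"])
  qed
  have Z_sum: "Z (\<lambda>t. \<Sum>i\<in>I. of_int (b i) * G i t)"
    if "finite I" "\<And>i. i \<in> I \<Longrightarrow> Z (G i)" for I and b :: "'i \<Rightarrow> int" and G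
    using that
  proof (induction I rule: finite_induct)
    case empty
    show ?case unfolding Z_def by (intro exI[of _ "\<lambda>_. 0"]) auto
  next
    case (insert i I)
    then show ?case by (auto intro!: Z_add Z_cmult)
  qed
  have Z_cong: "Z H" if "Z G" "\<And>t. t \<in> T \<Longrightarrow> G t = H t" for G H
    using that unfolding Z_def by auto
  have Z_mult: "Z (\<lambda>t. H t * G t)" if G: "Z G" and H: "\<And>e. e \<in> E \<Longrightarrow> Z (\<lambda>t. H t * m e t)" for G H
  proof -
    obtain b :: "(complex \<Rightarrow> nat) \<Rightarrow> int" where b: "\<And>t. t \<in> T \<Longrightarrow> G t = (\<Sum>e\<in>E. of_int (b e) * m e t)"
      using G unfolding Z_def by blast
    have "Z (\<lambda>t. \<Sum>e\<in>E. of_int (b e) * (H t * m e t))"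
      using fin(2) H by (rule Z_sum)
    then show ?thesis
      by (rule Z_cong) (simp add: b sum_distrib_left mult_ac)
  qed
  \<comment> \<open>The induction shows that multiplication by \<open>F\<close> preserves
    \<open>Z\<close>, not merely that \<open>F\<close> lies in \<open>Z\<close>; in this form
    products are handled by composing two multiplications.\<close>
  have "Z G \<Longrightarrow> Z (\<lambda>t. F t * G t)" for G
    using F
  proof (induction arbitrary: G)
    case (var x)
    show ?case
    proof (rule Z_mult[OF var.prems])
      fix e assume e: "e \<in> E"
      obtain c where c: "\<And>z. z \<in> alg_conjs x \<Longrightarrow>
           (of_int (l x) * z) ^ Suc (e x) = (\<Sum>j<alg_degree x. of_int (c j :: int) * (of_int (l x) * z) ^ j)"
        using scaled_conj_power_reduce[of x "e x"] V(2)[OF var.hyps] ED[OF e var.hyps]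
        unfolding l_def by blast
      define M where "M = (\<lambda>t. \<Prod>y\<in>V - {x}. (of_int (l y) * t y) ^ e y :: complex)"
      have m_eq: "m (e(x := j)) t = (of_int (l x) * t x) ^ j * M t" for j t
        unfolding m_def M_def using V var.hyps
        by (subst prod.remove[of _ x]) (auto intro!: prod.cong)
      have "Z (\<lambda>t. \<Sum>j<alg_degree x. of_int (c j) * m (e(x := j)) t)"
        using e var.hyps by (intro Z_sum Z_m) (auto simp: E_def PiE_iff extensional_def)
      then show "Z (\<lambda>t. of_int (lead_coeff (defining_poly x)) * t x * m e t)"
      proof (rule Z_cong)
        fix t assume "t \<in> T"
        then have "(\<Sum>j<alg_degree x. of_int (c j) * m (e(x := j)) t) =
           (of_int (l x) * t x) ^ Suc (e x) * M t"
          using c[OF TD] var.hyps by (simp only: m_eq sum_distrib_right mult.assoc)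
        also have "\<dots> = of_int (l x) * t x * m e t"
          using m_eq[of "e x" t] by simp
        finally show "(\<Sum>j<alg_degree x. of_int (c j) * m (e(x := j)) t) =
            of_int (lead_coeff (defining_poly x)) * t x * m e t" by (simp add: l_def)
      qed
    qed
  next
    case (mult F H)
    then show ?case by (simp add: mult.assoc)
  next
    case (add F H)
    then show ?case by (simp add: ring_distribs Z_add)
  qed (rule Z_cmult)
  then have "\<forall>e\<in>E. \<exists>b :: (complex \<Rightarrow> nat) \<Rightarrow> int. \<forall>t\<in>T. F t * m e t = (\<Sum>e'\<in>E. of_int (b e') * m e' t)"
    using Z_m unfolding Z_def by blast
  then obtain B :: "(complex \<Rightarrow> nat) \<Rightarrow> (complex \<Rightarrow> nat) \<Rightarrow> int"
    where "\<forall>e\<in>E. \<forall>t\<in>T. F t * m e t = (\<Sum>e'\<in>E. of_int (B e e') * m e' t)"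
    by metis
  then obtain p :: "int poly" where "map_poly of_int p = (\<Prod>t\<in>T. [:- F t, 1:])"
    using int_poly_prod_diag[OF fin card X, of F B] by blast
  then show ?thesis using prod_nonzero_ge_1[OF fin(1)] by (simp add: T_def)
qed

section \<open>Determinants of perturbed rank-one matrices\<close>

lemma norm_det_le:
  fixes A :: "complex mat"
  assumes A: "A \<in> carrier_mat n n"
    and le: "\<And>i j. i < n \<Longrightarrow> j < n \<Longrightarrow> norm (A $$ (i, j)) \<le> p i * q j"
  shows "norm (det A) \<le> fact n * ((\<Prod>i<n. p i) * (\<Prod>j<n. q j))"
proof -
  define S where "S = {\<sigma>. \<sigma> permutes {0..<n}}"
  have "norm (det A) \<le> (\<Sum>\<sigma>\<in>S. norm (signof \<sigma> * (\<Prod>i = 0..<n. A $$ (i, \<sigma> i))))"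
    unfolding det_def'[OF A] S_def by (rule norm_sum)
  also have "\<dots> \<le> (\<Sum>\<sigma>\<in>S. (\<Prod>i<n. p i) * (\<Prod>j<n. q j))"
  proof (rule sum_mono)
    fix \<sigma> assume "\<sigma> \<in> S"
    then have \<sigma>: "\<sigma> permutes {0..<n}" by (simp add: S_def)
    have "norm (signof \<sigma> * (\<Prod>i = 0..<n. A $$ (i, \<sigma> i))) = (\<Prod>i = 0..<n. norm (A $$ (i, \<sigma> i)))"
      by (simp add: norm_mult prod_norm[symmetric] sign_def)
    also have "\<dots> \<le> (\<Prod>i = 0..<n. p i * q (\<sigma> i))"
      using permutes_in_image[OF \<sigma>] by (intro prod_mono) (auto intro!: le)
    also have "\<dots> = (\<Prod>i<n. p i) * (\<Prod>j<n. q j)"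
      using prod.permute[OF \<sigma>, of q] by (simp add: prod.distrib comp_def lessThan_atLeast0)
    finally show "norm (signof \<sigma> * (\<Prod>i = 0..<n. A $$ (i, \<sigma> i))) \<le> (\<Prod>i<n. p i) * (\<Prod>j<n. q j)" .
  qed
  also have "\<dots> = fact n * ((\<Prod>i<n. p i) * (\<Prod>j<n. q j))"
    using card_permutations[of "{0..<n}" n] by (simp add: S_def)
  finally show ?thesis .
qed

text \<open>
  Bordering turns the perturbed rank-one matrix into one in which a term of the Leibniz expansion
  contains at most one \<open>u\<close> and one \<open>v\<close>.
\<close>

lemma det_rank_one_update:
  fixes e :: "nat \<Rightarrow> nat \<Rightarrow> 'a :: field"
  shows "det (mat n n (\<lambda>(i, j). u i * v j + e i j)) =
    det (mat (Suc n) (Suc n) (\<lambda>(i, j). case i of 0 \<Rightarrow> (case j of 0 \<Rightarrow> 1 | Suc j \<Rightarrow> - v j)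
       | Suc i \<Rightarrow> (case j of 0 \<Rightarrow> u i | Suc j \<Rightarrow> e i j)))" (is "det ?A = det ?B")
proof -
  define I where "I = (1\<^sub>m 1 :: 'a mat)"
  define R where "R = mat 1 n (\<lambda>(i, j). - v j)"
  define U where "U = mat n 1 (\<lambda>(i, j). u i)"
  define L where "L = four_block_mat I (0\<^sub>m 1 n) U (1\<^sub>m n)"
  define W where "W = four_block_mat I R (0\<^sub>m n 1) ?A"
  have carr: "L \<in> carrier_mat (Suc n) (Suc n)" "W \<in> carrier_mat (Suc n) (Suc n)"
    by (auto simp: L_def W_def I_def)
  have "det L = det I * det (1\<^sub>m n :: 'a mat)" unfolding L_def
    by (rule det_four_block_mat_upper_right_zero) (auto simp: I_def U_def)
  then have L: "det L = 1" by (simp add: I_def)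
  have "det W = det I * det ?A" unfolding W_def
    by (rule det_four_block_mat_lower_left_zero) (auto simp: I_def R_def)
  then have W: "det W = det ?A" by (simp add: I_def)
  \<comment> \<open>The block \<open>U * R\<close> has entries \<open>- u i * v j\<close>, which
    cancel the rank-one part of \<open>?A\<close> and leave \<open>e\<close>.\<close>
  have "L * W = four_block_mat (I * I + 0\<^sub>m 1 n * 0\<^sub>m n 1) (I * R + 0\<^sub>m 1 n * ?A)
      (U * I + 1\<^sub>m n * 0\<^sub>m n 1) (U * R + 1\<^sub>m n * ?A)"
    unfolding L_def W_def by (rule mult_four_block_mat) (auto simp: I_def R_def U_def)
  also have "\<dots> = ?B"
  proof (rule eq_matI)
    fix i j assume "i < dim_row ?B" "j < dim_col ?B"
    then show "four_block_mat (I * I + 0\<^sub>m 1 n * 0\<^sub>m n 1) (I * R + 0\<^sub>m 1 n * ?A)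
      (U * I + 1\<^sub>m n * 0\<^sub>m n 1) (U * R + 1\<^sub>m n * ?A) $$ (i, j) = ?B $$ (i, j)"
      by (cases i; cases j) (auto simp: I_def R_def U_def scalar_prod_def)
  qed (auto simp: I_def R_def U_def)
  finally have "det ?B = det L * det W" using det_mult[OF carr] by simp
  then show ?thesis by (simp add: L W)
qed

text \<open>The gain over the trivial bound is that \<open>U * V\<close> appears to the first power
  only. The factor \<epsilon> on the left avoids the exponent n - 1.\<close>

lemma norm_det_rank_one_update_le:
  fixes e :: "nat \<Rightarrow> nat \<Rightarrow> complex"
  assumes e: "\<And>i j. i < n \<Longrightarrow> j < n \<Longrightarrow> norm (e i j) \<le> \<epsilon>"
    and u: "\<And>i. i < n \<Longrightarrow> norm (u i) \<le> U" and v: "\<And>j. j < n \<Longrightarrow> norm (v j) \<le> V"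
    and \<epsilon>: "\<epsilon> > 0" "\<epsilon> \<le> U * V" "U \<ge> 0" "V \<ge> 0"
  shows "norm (det (mat n n (\<lambda>(i, j). u i * v j + e i j))) * \<epsilon> \<le> fact (Suc n) * (U * V * \<epsilon> ^ n)"
proof -
  define B where "B = mat (Suc n) (Suc n) (\<lambda>(i, j). case i of 0 \<Rightarrow> (case j of 0 \<Rightarrow> 1 | Suc j \<Rightarrow> - v j)
       | Suc i \<Rightarrow> (case j of 0 \<Rightarrow> u i | Suc j \<Rightarrow> e i j))"
  \<comment> \<open>These weights dominate the bordered matrix entrywise. The corner entry 1 is
    covered because \<epsilon> \<le> U V.\<close>
  define p where "p = (\<lambda>i :: nat. if i = 0 then V / \<epsilon> else 1)"
  define q where "q = (\<lambda>j :: nat. if j = 0 then U else \<epsilon>)"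
  have "norm (det B) \<le> fact (Suc n) * ((\<Prod>i<Suc n. p i) * (\<Prod>j<Suc n. q j))"
  proof (rule norm_det_le)
    fix i j assume "i < Suc n" "j < Suc n"
    then show "norm (B $$ (i, j)) \<le> p i * q j"
      using \<epsilon> e u v by (cases i; cases j) (auto simp: B_def p_def q_def divide_simps mult.commute)
  qed (simp add: B_def)
  also have "(\<Prod>i<Suc n. p i) = V / \<epsilon>"
    by (simp add: p_def prod.lessThan_Suc_shift del: prod.lessThan_Suc)
  also have "(\<Prod>j<Suc n. q j) = U * \<epsilon> ^ n"
    by (simp add: q_def prod.lessThan_Suc_shift del: prod.lessThan_Suc)
  finally show ?thesis
    unfolding det_rank_one_update B_def[symmetric]
    using \<epsilon> by (simp add: field_simps del: fact_Suc)
qed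

text \<open>Expanding along a new last column gives a linear combination of the rows whose last
  coefficient is the minor found before, hence nonzero; independence supplies a column where it does
  not vanish.\<close>

lemma exists_nonzero_minor:
  fixes l :: "nat \<Rightarrow> 'x \<Rightarrow> complex"
  assumes "\<And>c i. (\<And>x. x \<in> X \<Longrightarrow> (\<Sum>i<r. c i * l i x) = 0) \<Longrightarrow> i < r \<Longrightarrow> c i = 0"
  shows "\<exists>x. (\<forall>j<r. x j \<in> X) \<and> det (mat r r (\<lambda>(i, j). l i (x j))) \<noteq> 0"
  using assms
proof (induction r)
  case 0
  then show ?case by simp
next
  case (Suc r)
  have "c i = 0" if c: "\<And>x. x \<in> X \<Longrightarrow> (\<Sum>i<r. c i * l i x) = 0" and "i < r" for c i
  proof -
    have "(\<Sum>i<Suc r. (if i < r then c i else 0) * l i x) = 0" if "x \<in> X" for x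
      using c[OF that] by simp
    from Suc.prems[OF this, of i] \<open>i < r\<close> show ?thesis by simp
  qed
  then have "\<exists>x. (\<forall>j<r. x j \<in> X) \<and> det (mat r r (\<lambda>(i, j). l i (x j))) \<noteq> 0"
    by (rule Suc.IH)
  then obtain x where x: "\<forall>j<r. x j \<in> X" "det (mat r r (\<lambda>(i, j). l i (x j))) \<noteq> 0"
    by blast
  define A where "A = (\<lambda>y. mat (Suc r) (Suc r) (\<lambda>(i, j). l i ((x(r := y)) j)))"
  \<comment> \<open>Cofactors of the last column do not see its entries, so any value may stand
    there.\<close>
  define c where "c = (\<lambda>i. cofactor (A undefined) i r)"
  have cof: "cofactor (A y) i r = c i" if "i < Suc r" for i y
  proof -
    have "mat_delete (A y) i r = mat_delete (A undefined) i r"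
      using that by (intro eq_matI) (auto simp: A_def mat_delete_def)
    then show ?thesis by (simp add: c_def cofactor_def)
  qed
  have det: "det (A y) = (\<Sum>i<Suc r. c i * l i y)" for y
  proof -
    have "det (A y) = (\<Sum>i<Suc r. A y $$ (i, r) * cofactor (A y) i r)"
      by (rule laplace_expansion_column) (auto simp: A_def)
    also have "\<dots> = (\<Sum>i<Suc r. c i * l i y)"
      by (rule sum.cong) (simp_all add: cof mult.commute, simp add: A_def)
    finally show ?thesis .
  qed
  have "mat_delete (A undefined) r r = mat r r (\<lambda>(i, j). l i (x j))"
    by (intro eq_matI) (auto simp: A_def mat_delete_def)
  then have "c r \<noteq> 0" using x(2) by (simp add: c_def cofactor_def)
  then obtain y where y: "y \<in> X" "(\<Sum>i<Suc r. c i * l i y) \<noteq> 0"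
    using Suc.prems[of c r] by blast
  have "\<forall>j<Suc r. (x(r := y)) j \<in> X" using x y by (auto simp: less_Suc_eq)
  moreover have "det (mat (Suc r) (Suc r) (\<lambda>(i, j). l i ((x(r := y)) j))) \<noteq> 0"
    using y(2) det[of y] by (simp add: A_def)
  ultimately show ?case by blast
qed

section \<open>Closure properties of integral functions of conjugates\<close>

lemma int_funs_sum:
  "(\<And>i. i \<in> I \<Longrightarrow> F i \<in> int_funs V) \<Longrightarrow> (\<lambda>t. \<Sum>i\<in>I. F i t) \<in> int_funs V"
  using int_funs.of_int[of 0 V]
  by (induction I rule: infinite_finite_induct) (auto intro: int_funs.add)

lemma int_funs_prod:
  "(\<And>i. i \<in> I \<Longrightarrow> F i \<in> int_funs V) \<Longrightarrow> (\<lambda>t. \<Prod>i\<in>I. F i t) \<in> int_funs V"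
  using int_funs.of_int[of 1 V]
  by (induction I rule: infinite_finite_induct) (auto intro: int_funs.mult)

lemma int_funs_cmult: "F \<in> int_funs V \<Longrightarrow> (\<lambda>t. of_int k * F t) \<in> int_funs V"
  by (intro int_funs.mult int_funs.of_int)

lemma int_funs_cmult_nat: "F \<in> int_funs V \<Longrightarrow> (\<lambda>t. of_nat k * F t) \<in> int_funs V"
  using int_funs_cmult[of F V "int k"] by simp

lemma int_funs_diff: "F \<in> int_funs V \<Longrightarrow> G \<in> int_funs V \<Longrightarrow> (\<lambda>t. F t - G t) \<in> int_funs V"
  using int_funs.add[OF _ int_funs_cmult[of G V "-1"], of F] by simp

lemma int_funs_det:
  assumes "\<And>i j. i < n \<Longrightarrow> j < n \<Longrightarrow> F i j \<in> int_funs V"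
  shows "(\<lambda>t. det (mat n n (\<lambda>(i, j). F i j t))) \<in> int_funs V"
proof -
  have "(\<lambda>t. \<Sum>\<sigma>\<in>{\<sigma>. \<sigma> permutes {0..<n}}. of_int (sign \<sigma>) * (\<Prod>i = 0..<n. F i (\<sigma> i) t)) \<in> int_funs V"
    using assms by (intro int_funs_sum int_funs_cmult int_funs_prod) (auto simp: permutes_in_image)
  also have "(\<lambda>t. \<Sum>\<sigma>\<in>{\<sigma>. \<sigma> permutes {0..<n}}. of_int (sign \<sigma>) * (\<Prod>i = 0..<n. F i (\<sigma> i) t)) =
      (\<lambda>t. det (mat n n (\<lambda>(i, j). F i j t)))"
  proof
    fix t
    have "(\<Sum>\<sigma>\<in>{\<sigma>. \<sigma> permutes {0..<n}}. of_int (sign \<sigma>) * (\<Prod>i = 0..<n. F i (\<sigma> i) t)) =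
       (\<Sum>\<sigma>\<in>{\<sigma>. \<sigma> permutes {0..<n}}. signof \<sigma> *
          (\<Prod>i = 0..<n. mat n n (\<lambda>(i, j). F i j t) $$ (i, \<sigma> i)))"
    proof (rule sum.cong[OF refl])
      fix \<sigma> assume "\<sigma> \<in> {\<sigma>. \<sigma> permutes {0..<n}}"
      then have "i < n \<Longrightarrow> \<sigma> i < n" for i using permutes_in_image[of \<sigma> "{0..<n}" i] by simp
      then show "of_int (sign \<sigma>) * (\<Prod>i = 0..<n. F i (\<sigma> i) t) =
          signof \<sigma> * (\<Prod>i = 0..<n. mat n n (\<lambda>(i, j). F i j t) $$ (i, \<sigma> i))"
        by (intro arg_cong2[of _ _ _ _ "(*)"] prod.cong) (auto simp: sign_def)
    qed
    then show "(\<Sum>\<sigma>\<in>{\<sigma>. \<sigma> permutes {0..<n}}. of_int (sign \<sigma>) * (\<Prod>i = 0..<n. F i (\<sigma> i) t)) =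
      det (mat n n (\<lambda>(i, j). F i j t))"
      by (subst det_def'[of _ n]) auto
  qed
  finally show ?thesis .
qed

section \<open>Hermite approximations of the exponential function\<close>

text \<open>
  \<open>lap p\<close> is the integral of \<open>p x * exp (- x)\<close> over the positive half-line, so \<open>lap (pcompose f [:c, 1:])\<close>
  is the sum of all derivatives of \<open>f\<close> at \<open>c\<close>.
\<close>

definition lap :: "complex poly \<Rightarrow> complex" where
  "lap p = (\<Sum>r\<le>degree p. fact r * coeff p r)"

lemma lap_altdef: "degree p \<le> N \<Longrightarrow> lap p = (\<Sum>r\<le>N. fact r * coeff p r)"
  unfolding lap_def by (rule sum.mono_neutral_left) (auto simp: coeff_eq_0)

lemma lap_add: "lap (p + q) = lap p + lap q"
  using lap_altdef[of p "max (degree p) (degree q)"] lap_altdef[of q "max (degree p) (degree q)"]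
    lap_altdef[of "p + q" "max (degree p) (degree q)"] degree_add_le_max[of p q]
  by (simp add: ring_distribs sum.distrib)

lemma lap_smult: "lap (smult c p) = c * lap p"
  using lap_altdef[OF degree_smult_le[of c p]] by (simp add: lap_def sum_distrib_left mult_ac)

lemma lap_0 [simp]: "lap 0 = 0"
  by (simp add: lap_def)

lemma lap_diff: "lap (p - q) = lap p - lap q"
  using lap_add[of "p - q" q] by simp

lemma lap_sum: "lap (\<Sum>i\<in>I. p i) = (\<Sum>i\<in>I. lap (p i))"
  by (induction I rule: infinite_finite_induct) (simp_all add: lap_add)

text \<open>Integration by parts: \<open>- p x * exp (- x)\<close> is an antiderivative of the
  integrand.\<close>

lemma lap_diff_pderiv: "lap (p - pderiv p) = coeff p 0"
proof -
  have "degree (p - pderiv p) \<le> degree p"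
    by (rule degree_diff_le) (simp_all add: degree_pderiv)
  then have "lap (p - pderiv p) = (\<Sum>r\<le>degree p. fact r * coeff p r - fact (Suc r) * coeff p (Suc r))"
    by (subst lap_altdef[of _ "degree p"]) (simp_all add: coeff_pderiv ring_distribs mult_ac)
  also have "\<dots> = coeff p 0"
    by (subst sum_telescope) (simp add: coeff_eq_0)
  finally show ?thesis .
qed

lemma lap_linear_power:
  "lap ([:c, 1:] ^ N) = fact N * (\<Sum>l\<le>N. c ^ l / fact l)"
proof -
  have "lap ([:c, 1:] ^ N) = (\<Sum>r\<le>N. fact r * (of_nat (N choose r) * c ^ (N - r)))"
    by (subst lap_altdef[of _ N]) (simp_all add: degree_linear_power coeff_linear_poly_power)
  also have "\<dots> = (\<Sum>r\<le>N. fact N * (c ^ (N - r) / fact (N - r)))"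
    by (rule sum.cong) (simp_all add: binomial_fact field_simps)
  also have "\<dots> = (\<Sum>l\<le>N. fact N * (c ^ l / fact l))"
    by (rule sum.reindex_bij_witness[of _ "\<lambda>l. N - l" "\<lambda>l. N - l"]) auto
  finally show ?thesis by (simp add: sum_distrib_left)
qed

text \<open>By \<open>lap_linear_power\<close>, \<open>lap\<close> produces \<open>fact N\<close>
  times a partial sum of the exponential series. In the tail, N! (n+1)! \<le> (N+n+1)! cancels the
  factor \<open>fact N\<close>, so the error carries no factorial.\<close>

lemma exp_taylor_remainder:
  fixes c :: complex
  shows "norm (exp c * fact N - lap ([:c, 1:] ^ N)) \<le> exp (norm c) * norm c ^ N"
proof -
  define f where "f = (\<lambda>n. c ^ n / fact n)"
  define g where "g = (\<lambda>n. norm c ^ n / fact n)"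
  have f: "summable f" "(\<Sum>n. f n) = exp c"
    using exp_converges[of c] by (auto simp: sums_iff f_def scaleR_conv_of_real field_simps)
  have g: "summable g" "(\<Sum>n. g n) = exp (norm c)"
    using exp_converges[of "norm c"] by (auto simp: sums_iff g_def field_simps)
  have "exp c = (\<Sum>n. f (n + Suc N)) + (\<Sum>n<Suc N. f n)"
    using suminf_split_initial_segment[OF f(1), of "Suc N"] f(2) by simp
  then have "exp c * fact N - lap ([:c, 1:] ^ N) = fact N * (\<Sum>n. f (n + Suc N))"
    by (simp add: lap_linear_power f_def lessThan_Suc_atMost ring_distribs)
  also have "\<dots> = (\<Sum>n. fact N * f (n + Suc N))"
    using f(1) by (intro suminf_mult[symmetric]) (simp only: summable_iff_shift)
  also have "norm \<dots> \<le> (\<Sum>n. norm c ^ N * g (Suc n))"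
  proof (rule norm_suminf_le)
    fix n
    have "fact N * fact (Suc n) \<le> (fact (N + Suc n) :: nat)"
      by (intro dvd_imp_le fact_fact_dvd_fact) simp
    then have "real (fact N * fact (Suc n)) \<le> real (fact (N + Suc n))"
      by (simp only: of_nat_le_iff)
    then have "(fact N :: real) / fact (N + Suc n) \<le> 1 / fact (Suc n)"
      by (simp add: divide_simps del: fact_Suc)
    then have "norm c ^ (N + Suc n) * (fact N / fact (N + Suc n)) \<le> norm c ^ (N + Suc n) * (1 / fact (Suc n))"
      by (intro mult_left_mono) auto
    then show "norm (fact N * f (n + Suc N)) \<le> norm c ^ N * g (Suc n)"
      by (simp add: f_def g_def norm_mult norm_divide norm_power power_add add_ac mult_ac
          del: fact_Suc)
  next
    show "summable (\<lambda>n. norm c ^ N * g (Suc n))"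
      using g(1) by (intro summable_mult) (simp only: summable_Suc_iff)
  qed
  also have "\<dots> = norm c ^ N * (\<Sum>n. g (Suc n))"
    using g(1) by (intro suminf_mult) (simp only: summable_Suc_iff)
  also have "(\<Sum>n. g (Suc n)) = exp (norm c) - 1"
    using suminf_split_head[OF g(1)] g(2) by (simp add: g_def)
  also have "norm c ^ N * (exp (norm c) - 1) \<le> norm c ^ N * exp (norm c)"
    by (intro mult_left_mono) auto
  finally show ?thesis by (simp add: mult_ac)
qed

lemma pcompose_expand:
  fixes p q :: "'a :: comm_ring_1 poly"
  shows "pcompose p q = (\<Sum>i\<le>degree p. smult (coeff p i) (q ^ i))"
proof -
  have "pcompose (monom a i) q = smult a (q ^ i)" for a :: 'a and i
  proof (induction i)
    case (Suc i)
    then show ?case by (simp add: monom_Suc pcompose_pCons)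
  qed (simp add: monom_0)
  then show ?thesis
    by (subst poly_as_sum_of_monoms[of p, symmetric]) (simp only: pcompose_sum)
qed

text \<open>Both sides of the approximation are linear in \<open>f\<close>, so the remainder
  estimate applies monomial by monomial.\<close>

lemma lap_shift_approx:
  "norm (exp c * lap f - lap (pcompose f [:c, 1:]))
     \<le> exp (norm c) * (\<Sum>i\<le>degree f. norm (coeff f i) * norm c ^ i)"
proof -
  have "exp c * lap f - lap (pcompose f [:c, 1:]) =
      (\<Sum>i\<le>degree f. coeff f i * (exp c * fact i - lap ([:c, 1:] ^ i)))"
    unfolding lap_def[of f]
    by (simp add: pcompose_expand lap_sum lap_smult sum_distrib_left sum_subtractf
        right_diff_distrib mult_ac)
  also have "norm \<dots> \<le> (\<Sum>i\<le>degree f. norm (coeff f i) * (exp (norm c) * norm c ^ i))"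
    by (rule sum_norm_le) (simp add: norm_mult mult_left_mono exp_taylor_remainder)
  finally show ?thesis by (simp add: sum_distrib_left mult_ac)
qed

section \<open>Coefficientwise majorants\<close>

definition majorizes :: "real poly \<Rightarrow> complex poly \<Rightarrow> bool" where
  "majorizes P f \<longleftrightarrow> (\<forall>i. norm (coeff f i) \<le> coeff P i)"

lemma majorizes_mult:
  assumes "majorizes P f" "majorizes Q g"
  shows "majorizes (P * Q) (f * g)"
  unfolding majorizes_def
proof
  fix i
  have "norm (coeff (f * g) i) \<le> (\<Sum>k\<le>i. norm (coeff f k * coeff g (i - k)))"
    by (simp add: coeff_mult norm_sum)
  also have "\<dots> \<le> (\<Sum>k\<le>i. coeff P k * coeff Q (i - k))"
    using assms unfolding majorizes_def norm_mult
    by (intro sum_mono mult_mono) (auto intro: order_trans[OF norm_ge_zero])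
  finally show "norm (coeff (f * g) i) \<le> coeff (P * Q) i" by (simp add: coeff_mult)
qed

lemma majorizes_1: "majorizes 1 1"
  by (auto simp: majorizes_def)

lemma majorizes_power: "majorizes P f \<Longrightarrow> majorizes (P ^ n) (f ^ n)"
  by (induction n) (auto intro: majorizes_mult majorizes_1)

lemma majorizes_prod:
  "(\<And>x. x \<in> A \<Longrightarrow> majorizes (P x) (f x)) \<Longrightarrow> majorizes (\<Prod>x\<in>A. P x) (\<Prod>x\<in>A. f x)"
  by (induction A rule: infinite_finite_induct) (auto intro: majorizes_mult majorizes_1)

lemma majorizes_linear: "norm a \<le> b \<Longrightarrow> majorizes [:b, 1:] [:a, 1:]"
  by (auto simp: majorizes_def coeff_pCons split: nat.split)

lemma majorizes_monom: "majorizes (monom 1 j) (monom 1 j)"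
  by (auto simp: majorizes_def)

lemma majorizes_sum_le:
  assumes "majorizes P f" "r \<ge> 0"
  shows "(\<Sum>i\<le>degree f. norm (coeff f i) * r ^ i) \<le> poly P r"
proof -
  define N where "N = max (degree f) (degree P)"
  have P: "coeff P i \<ge> 0" for i
    using assms(1) by (meson majorizes_def norm_ge_zero order_trans)
  have "(\<Sum>i\<le>degree f. norm (coeff f i) * r ^ i) \<le> (\<Sum>i\<le>degree f. coeff P i * r ^ i)"
    using assms by (intro sum_mono mult_right_mono) (auto simp: majorizes_def)
  also have "\<dots> \<le> (\<Sum>i\<le>N. coeff P i * r ^ i)"
    using assms(2) P by (intro sum_mono2) (auto simp: N_def)
  also have "\<dots> = poly P r"
    unfolding poly_altdef by (rule sum.mono_neutral_right) (auto simp: N_def coeff_eq_0)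
  finally show ?thesis .
qed

lemma norm_lap_le:
  assumes "majorizes P f" "degree f \<le> N"
  shows "norm (lap f) \<le> fact N * poly P 1"
proof -
  have "norm (lap f) \<le> (\<Sum>r\<le>degree f. norm (coeff f r) * fact N)"
    unfolding lap_def
  proof (rule sum_norm_le)
    fix r assume "r \<in> {..degree f}"
    then have "(fact r :: real) \<le> fact N" using assms by (intro fact_mono) auto
    then show "norm (fact r * coeff f r) \<le> norm (coeff f r) * fact N"
      by (simp add: norm_mult mult.commute mult_right_mono)
  qed
  also have "\<dots> = fact N * (\<Sum>r\<le>degree f. norm (coeff f r) * 1 ^ r)"
    by (simp add: sum_distrib_left mult_ac)
  also have "\<dots> \<le> fact N * poly P 1"
    using majorizes_sum_le[OF assms(1), of 1] by (intro mult_left_mono) auto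
  finally show ?thesis .
qed

section \<open>Nonvanishing of the Hermite approximations\<close>

lemma bezout_pderiv_prod_linear:
  fixes S :: "complex set"
  assumes "finite S"
  defines "g \<equiv> \<Prod>\<gamma>\<in>S. [:- \<gamma>, 1:]"
  shows "\<exists>a b. a * g + b * pderiv g = 1"
proof -
  have no_root: "\<not> (poly g z = 0 \<and> poly (pderiv g) z = 0)" for z
  proof (cases "z \<in> S")
    case True
    define k where "k = (\<Prod>\<gamma>\<in>S - {z}. [:- \<gamma>, 1:])"
    have "g = [:- z, 1:] * k" using True assms by (simp add: k_def prod.remove)
    then have "poly (pderiv g) z = poly k z"
      by (simp only: pderiv_mult) (simp add: pderiv_pCons)
    also have "\<dots> \<noteq> 0" using assms by (simp add: k_def poly_prod)
    finally show ?thesis by simp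
  qed (use assms in \<open>simp add: poly_prod\<close>)
  define G where "G = gcd g (pderiv g)"
  have "degree G = 0"
  proof (rule ccontr)
    assume "degree G \<noteq> 0"
    then have "\<not> constant (poly G)" by (simp add: constant_degree)
    then obtain z where "poly G z = 0"
      using fundamental_theorem_of_algebra by blast
    then have "[:- z, 1:] dvd gcd g (pderiv g)" by (simp only: poly_eq_0_iff_dvd G_def)
    then show False using no_root[of z] by (simp only: poly_eq_0_iff_dvd gcd_greatest_iff) blast
  qed
  moreover have "G \<noteq> 0"
    using no_root[of 0] unfolding G_def gcd_eq_0_iff by force
  ultimately obtain c where c: "G = [:c:]" "c \<noteq> 0"
    by (metis degree_eq_zeroE pCons_0_0)
  define a b where "a = fst (bezout_coefficients g (pderiv g))"
    and "b = snd (bezout_coefficients g (pderiv g))"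
  have "a * g + b * pderiv g = [:c:]"
    unfolding a_def b_def c(1)[symmetric] G_def by (rule bezout_coefficients_fst_snd)
  then have "smult (inverse c) (a * g + b * pderiv g) = 1"
    using c by (simp add: one_pCons)
  then have "smult (inverse c) a * g + smult (inverse c) b * pderiv g = 1"
    by (simp add: smult_add_right)
  then show ?thesis by blast
qed

text \<open>
  The functional \<open>L\<close> below satisfies \<open>L (f - f') = L0 f\<close>. With \<open>f = g ^ (k + 1) * h\<close> this makes \<open>L\<close> vanish on
  \<open>g ^ n * h\<close> for \<open>h\<close> of any degree, and then on \<open>g ^ k * h\<close> for decreasing \<open>k\<close>, since \<open>g\<close> and \<open>g'\<close> are coprime.
\<close>

theorem hermite_nonvanishing:
  fixes S :: "complex set" and x :: "complex \<Rightarrow> complex"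
  assumes fin: "finite S"
  defines "g \<equiv> \<Prod>\<gamma>\<in>S. [:- \<gamma>, 1:]"
  assumes zero: "\<And>j. j < card S \<Longrightarrow>
      (\<Sum>\<gamma>\<in>S. x \<gamma> * lap (pcompose (monom 1 j * g ^ n) [:\<gamma>, 1:])) = 0"
  assumes \<gamma>: "\<gamma> \<in> S"
  shows "x \<gamma> = 0"
proof -
  define L where "L = (\<lambda>f. \<Sum>\<gamma>\<in>S. x \<gamma> * lap (pcompose f [:\<gamma>, 1:]))"
  define L0 where "L0 = (\<lambda>f. \<Sum>\<gamma>\<in>S. x \<gamma> * poly f \<gamma>)"
  have L_add: "L (p + q) = L p + L q" for p q
    by (simp add: L_def pcompose_add lap_add ring_distribs sum.distrib)
  have L_diff: "L (p - q) = L p - L q" for p q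
    by (simp add: L_def pcompose_diff lap_diff ring_distribs sum_subtractf)
  have L_smult: "L (smult c p) = c * L p" for c p
    by (simp add: L_def pcompose_smult lap_smult sum_distrib_left mult_ac)
  have L_0: "L 0 = 0" by (simp add: L_def)
  have L_sum: "L (\<Sum>i\<in>I. p i) = (\<Sum>i\<in>I. L (p i))" for I :: "nat set" and p
    by (induction I rule: infinite_finite_induct) (simp_all add: L_add L_0)
  have key: "L (f - pderiv f) = L0 f" for f
  proof -
    have "lap (pcompose (f - pderiv f) [:c, 1:]) = poly f c" for c
      using lap_diff_pderiv[of "pcompose f [:c, 1:]"]
      by (simp add: pcompose_diff pderiv_pcompose pderiv_pCons poly_0_coeff_0[symmetric] poly_pcompose)
    then show ?thesis by (simp add: L_def L0_def)
  qed
  have g_root: "poly g z = 0" if "z \<in> S" for z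
    using that fin by (simp add: g_def poly_prod)
  have L0_g: "L0 (g ^ Suc k * h) = 0" for k h
    by (simp add: L0_def g_root)
  have step: "g ^ Suc k * h - pderiv (g ^ Suc k * h) =
      g ^ k * (g * h - smult (of_nat (Suc k)) (pderiv g * h) - g * pderiv h)" for k h
  proof -
    have "pderiv (g ^ Suc k * h) =
        g ^ Suc k * pderiv h + h * (smult (of_nat (Suc k)) (g ^ k) * pderiv g)"
      by (simp only: pderiv_mult pderiv_power_Suc)
    then show ?thesis by (simp add: algebra_simps)
  qed
  have L_step: "L (g ^ k * (g * h - smult (of_nat (Suc k)) (pderiv g * h) - g * pderiv h)) = 0" for k h
    using key[of "g ^ Suc k * h"] L0_g[of k h] unfolding step by simp
  define M where "M = card S"
  have "M > 0" using fin \<gamma> by (auto simp: M_def card_gt_0_iff)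
  have g: "degree g = M" "coeff g M = 1" "g \<noteq> 0"
  proof -
    have "degree g = (\<Sum>\<gamma>\<in>S. degree [:- \<gamma>, 1:])" unfolding g_def
      by (rule degree_prod_eq_sum_degree) auto
    then show "degree g = M" by (simp add: M_def)
    have "lead_coeff g = 1" by (simp add: g_def lead_coeff_prod)
    then show "coeff g M = 1" "g \<noteq> 0" using \<open>degree g = M\<close> by auto
  qed
  have top: "L (g ^ n * h) = 0" for h
  proof (induction "degree h" arbitrary: h rule: less_induct)
    case less
    show ?case
    proof (cases "degree h < M")
      case True
      have "g ^ n * h = (\<Sum>i\<le>degree h. smult (coeff h i) (monom 1 i * g ^ n))"
        by (subst poly_as_sum_of_monoms[of h, symmetric])
          (simp add: sum_distrib_left smult_monom mult.commute flip: mult_smult_left)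
      also have "L \<dots> = 0"
        unfolding L_sum L_smult using zero True by (intro sum.neutral) (auto simp: L_def M_def)
      finally show ?thesis .
    next
      case False
      define D where "D = degree h"
      \<comment> \<open>With this choice \<open>k\<close> has the leading term of \<open>h\<close>:
        \<open>g\<close> is monic of degree \<open>M\<close>, and both terms containing a derivative
        have lower degree. Since \<open>L_step\<close> annihilates \<open>g ^ n * k\<close>, the
        induction continues with \<open>h - k\<close>.\<close>
      define h1 where "h1 = monom (lead_coeff h) (D - M)"
      define k where "k = g * h1 - smult (of_nat (Suc n)) (pderiv g * h1) - g * pderiv h1"
      have D: "D \<ge> M" using False by (simp add: D_def)
      have "coeff (h - k) i = 0" if "i > D - 1" for i
      proof -
        have "D \<le> i" using that by linarith
        have d1: "degree h1 \<le> D - M" unfolding h1_def by (rule degree_monom_le)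
        have "degree (pderiv g * h1) \<le> (M - 1) + (D - M)"
          using d1 g by (intro order_trans[OF degree_mult_le] add_mono) (auto simp: degree_pderiv)
        then have c1: "coeff (pderiv g * h1) i = 0"
          using \<open>D \<le> i\<close> D \<open>M > 0\<close> by (intro coeff_eq_0) linarith
        have c2: "coeff (g * pderiv h1) i = 0"
        proof (cases "D = M")
          case True
          then have "pderiv h1 = 0" by (simp add: h1_def monom_0 pderiv_pCons)
          then show ?thesis by simp
        next
          case False
          have "degree (g * pderiv h1) \<le> M + (D - M - 1)"
            using d1 g by (intro order_trans[OF degree_mult_le] add_mono) (auto simp: degree_pderiv)
          then show ?thesis using \<open>D \<le> i\<close> D False by (intro coeff_eq_0) linarith
        qed
        have c3: "coeff h i = coeff (g * h1) i"
        proof (cases "i = D")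
          case True
          have "coeff (g * h1) i = lead_coeff h * coeff g (i - (D - M))"
            using True by (simp add: h1_def mult.commute[of g] coeff_monom_mult)
          then show ?thesis using True D g by (simp add: D_def)
        next
          case False
          have "degree (g * h1) \<le> M + (D - M)"
            using d1 g by (intro order_trans[OF degree_mult_le] add_mono) auto
          then show ?thesis using False \<open>D \<le> i\<close> D by (simp add: coeff_eq_0 D_def)
        qed
        show ?thesis using c1 c2 c3 by (simp add: k_def)
      qed
      then have "degree (h - k) \<le> D - 1" by (intro degree_le) auto
      then have "L (g ^ n * (h - k)) = 0"
        using D \<open>M > 0\<close> by (intro less) (simp add: D_def)
      moreover have "L (g ^ n * k) = 0" unfolding k_def by (rule L_step)
      ultimately show ?thesis by (simp add: right_diff_distrib L_diff)
    qed
  qed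
  obtain a b where ab: "a * g + b * pderiv g = 1"
    using bezout_pderiv_prod_linear[OF fin] unfolding g_def by blast
  have down: "\<forall>h. L (g ^ k * h) = 0" if "\<forall>h. L (g ^ Suc k * h) = 0" for k
  proof
    fix h
    define u where "u = b * h"
    \<comment> \<open>The relation of \<open>L_step\<close>, solved for the term with
      \<open>pderiv g\<close>; the Bezout identity then splits an arbitrary \<open>h\<close> into
      multiples of \<open>g\<close> and of \<open>pderiv g\<close>.\<close>
    have "smult (of_nat (Suc k)) (g ^ k * (pderiv g * u)) =
        g ^ Suc k * (u - pderiv u)
        - g ^ k * (g * u - smult (of_nat (Suc k)) (pderiv g * u) - g * pderiv u)"
      by (simp add: algebra_simps)
    then have "of_nat (Suc k) * L (g ^ k * (pderiv g * u)) = 0"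
      using that L_step[of k u] by (metis L_diff L_smult diff_zero)
    then have "L (g ^ k * (pderiv g * u)) = 0"
      by (metis mult_eq_0_iff of_nat_neq_0)
    moreover have "g ^ k * h = g ^ Suc k * (a * h) + g ^ k * (pderiv g * u)"
    proof -
      have "g ^ k * h = g ^ k * (a * g + b * pderiv g) * h" by (simp add: ab)
      then show ?thesis by (simp add: u_def algebra_simps)
    qed
    ultimately show "L (g ^ k * h) = 0" using that by (simp only: L_add) simp
  qed
  have "\<forall>h. L (g ^ (n - k) * h) = 0" if "k \<le> n" for k
    using that
  proof (induction k)
    case (Suc k)
    then have eq: "Suc (n - Suc k) = n - k" by simp
    have "\<forall>h. L (g ^ Suc (n - Suc k) * h) = 0"
      unfolding eq using Suc by (intro Suc.IH) simp
    then show ?case by (rule down)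
  qed (use top in simp)
  from this[of n] have "L h = 0" for h by simp
  then have L0: "L0 h = 0" for h using key[of h] by simp
  \<comment> \<open>A polynomial vanishing on all points except \<gamma> isolates the coefficient
    \<open>x \<gamma>\<close>.\<close>
  define q where "q = (\<Prod>c\<in>S - {\<gamma>}. [:- c, 1:])"
  have q: "poly q c = 0 \<longleftrightarrow> c \<in> S - {\<gamma>}" for c using fin by (auto simp: q_def poly_prod)
  have "L0 q = x \<gamma> * poly q \<gamma> + (\<Sum>c\<in>S - {\<gamma>}. x c * poly q c)"
    unfolding L0_def by (rule sum.remove[OF fin \<gamma>])
  also have "(\<Sum>c\<in>S - {\<gamma>}. x c * poly q c) = 0"
    by (rule sum.neutral) (use q in fastforce)
  finally show ?thesis using L0[of q] q[of \<gamma>] by simp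
qed

section \<open>The determinant argument\<close>

text \<open>Here \<open>q\<close> is a common denominator, and the weight counts how many factors
  \<open>q\<close> clear all coefficients; weights add under multiplication.\<close>

definition weighted_int :: "complex set \<Rightarrow> nat \<Rightarrow> nat \<Rightarrow> ((complex \<Rightarrow> complex) \<Rightarrow> complex poly) \<Rightarrow> bool" where
  "weighted_int V q w P \<longleftrightarrow> (\<forall>r. (\<lambda>t. of_nat q ^ w * coeff (P t) r) \<in> int_funs V)"

lemma weighted_int_mult:
  assumes "weighted_int V q v P" "weighted_int V q w Q"
  shows "weighted_int V q (v + w) (\<lambda>t. P t * Q t)"
  unfolding weighted_int_def
proof
  fix r
  have "(\<lambda>t. \<Sum>i\<le>r. (of_nat q ^ v * coeff (P t) i) * (of_nat q ^ w * coeff (Q t) (r - i))) \<in> int_funs V"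
    using assms unfolding weighted_int_def by (intro int_funs_sum) (rule int_funs.mult; simp)
  then show "(\<lambda>t. of_nat q ^ (v + w) * coeff (P t * Q t) r) \<in> int_funs V"
    by (simp add: coeff_mult sum_distrib_left power_add mult_ac)
qed

lemma int_funs_0: "(\<lambda>_. 0) \<in> int_funs V"
  using int_funs.of_int[of 0] by simp

lemma int_funs_nat_power: "(\<lambda>_. of_nat q ^ w) \<in> int_funs V"
  using int_funs.of_int[of "int q ^ w"] by simp

lemma weighted_int_1: "weighted_int V q w (\<lambda>_. 1)"
  unfolding weighted_int_def
  by (auto simp: int_funs_0 int_funs_nat_power split: if_splits)

lemma weighted_int_power: "weighted_int V q w P \<Longrightarrow> weighted_int V q (n * w) (\<lambda>t. P t ^ n)"
  by (induction n) (auto intro: weighted_int_mult weighted_int_1)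

lemma weighted_int_prod:
  "(\<And>i. i \<in> I \<Longrightarrow> weighted_int V q w (P i)) \<Longrightarrow> weighted_int V q (card I * w) (\<lambda>t. \<Prod>i\<in>I. P i t)"
  by (induction I rule: infinite_finite_induct) (auto intro: weighted_int_mult weighted_int_1)

lemma weighted_int_linear:
  assumes "(\<lambda>t. of_nat q * a t) \<in> int_funs V"
  shows "weighted_int V q 1 (\<lambda>t. [:a t, 1:])"
  unfolding weighted_int_def
proof
  fix r
  consider "r = 0" | "r = 1" | s where "r = Suc (Suc s)" by (metis One_nat_def not0_implies_Suc)
  then show "(\<lambda>t. of_nat q ^ 1 * coeff [:a t, 1:] r) \<in> int_funs V"
    by cases (use assms int_funs_nat_power[of q 1 V] int_funs_0[of V] in simp_all)
qed

lemma int_funs_weight_mono: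
  assumes "(\<lambda>t. of_nat q ^ v * F t) \<in> int_funs V" "v \<le> w"
  shows "(\<lambda>t. of_nat q ^ w * F t) \<in> int_funs V"
proof -
  have "(\<lambda>t. of_nat q ^ (w - v) * (of_nat q ^ v * F t)) \<in> int_funs V"
    by (intro int_funs.mult int_funs_nat_power assms)
  then show ?thesis using assms(2) by (simp add: mult.assoc[symmetric] power_add[symmetric])
qed

text \<open>A zero of order \<open>n\<close> at the origin leaves only the factorials (n+r)!, all
  divisible by n!. This division is what makes the approximation errors small.\<close>

lemma int_funs_lap:
  assumes P: "weighted_int V q w P" and deg: "\<And>t. degree (P t) \<le> N"
  shows "(\<lambda>t. of_nat q ^ w * (lap (monom 1 n * P t) / fact n)) \<in> int_funs V"
proof -
  have "(\<lambda>t. \<Sum>r\<le>N. of_nat (fact (n + r) div fact n) * (of_nat q ^ w * coeff (P t) r)) \<in> int_funs V"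
    using P unfolding weighted_int_def by (intro int_funs_sum int_funs_cmult_nat) auto
  moreover have "(\<Sum>r\<le>N. of_nat (fact (n + r) div fact n) * (of_nat q ^ w * coeff (P t) r)) =
      of_nat q ^ w * (lap (monom 1 n * P t) / fact n)" for t
  proof -
    have "degree (monom 1 n * P t) \<le> n + N"
      using deg[of t] by (intro order_trans[OF degree_mult_le]) (simp add: degree_monom_eq)
    then have "lap (monom 1 n * P t) = (\<Sum>r\<le>n + N. fact r * coeff (monom 1 n * P t) r)"
      by (rule lap_altdef)
    also have "\<dots> = (\<Sum>r\<in>{n..n + N}. fact r * coeff (monom 1 n * P t) r)"
      by (rule sum.mono_neutral_right) (auto simp: coeff_monom_mult)
    also have "\<dots> = (\<Sum>r\<le>N. fact (n + r) * coeff (P t) r)"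
      by (rule sum.reindex_bij_witness[of _ "\<lambda>r. n + r" "\<lambda>r. r - n"])
        (auto simp: coeff_monom_mult)
    finally have lap: "lap (monom 1 n * P t) = (\<Sum>r\<le>N. fact (n + r) * coeff (P t) r)" .
    have "(of_nat (fact (n + r) div fact n) :: complex) = fact (n + r) / fact n" for r
    proof -
      obtain c :: nat where c: "fact (n + r) = fact n * c"
        using fact_dvd[of n "n + r"] by (auto elim: dvdE)
      then have "(fact (n + r) :: complex) = fact n * of_nat c"
        by (metis of_nat_fact of_nat_mult)
      then show ?thesis using c by simp
    qed
    then show ?thesis unfolding lap by (simp add: sum_divide_distrib sum_distrib_left mult_ac)
  qed
  ultimately show ?thesis by simp
qed

section \<open>Leading terms in the group algebra of the complex numbers\<close>

lemma lex_max_exists: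
  fixes A :: "complex set"
  assumes "finite A" "A \<noteq> {}"
  shows "\<exists>z\<in>A. \<forall>w\<in>A. Re w < Re z \<or> Re w = Re z \<and> Im w \<le> Im z"
proof -
  define B where "B = {z\<in>A. Re z = Max (Re ` A)}"
  have "Max (Re ` A) \<in> Re ` A" using assms by (intro Max_in) auto
  then obtain a where "a \<in> A" "Re a = Max (Re ` A)" by (metis imageE)
  then have B: "finite B" "B \<noteq> {}" using assms by (auto simp: B_def)
  then have "Max (Im ` B) \<in> Im ` B" by (intro Max_in) auto
  then obtain z where z: "z \<in> B" "Im z = Max (Im ` B)" by auto
  have "Re w < Re z \<or> Re w = Re z \<and> Im w \<le> Im z" if w: "w \<in> A" for w
  proof (cases "w \<in> B")
    case True
    then show ?thesis using z B by (auto simp: B_def)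
  next
    case False
    have "Re w \<le> Max (Re ` A)" using w assms by auto
    then show ?thesis using False w z by (auto simp: B_def)
  qed
  then show ?thesis using z(1) unfolding B_def by blast
qed

text \<open>
  The group algebra of the additive group of complex numbers has no zero divisors: the product of
  the lexicographically leading terms cannot cancel.
\<close>

lemma group_algebra_no_zero_divisor:
  fixes y :: "complex \<Rightarrow> complex" and \<alpha> \<beta> :: "'i \<Rightarrow> complex"
  assumes fin: "finite R" "finite I" and I: "I \<noteq> {}" and inj: "inj_on \<alpha> I"
    and \<beta>: "\<And>i. i \<in> I \<Longrightarrow> \<beta> i \<noteq> 0"
    and zero: "\<And>s i. s \<in> R \<Longrightarrow> i \<in> I \<Longrightarrow>
      (\<Sum>(s', i')\<in>{p \<in> R \<times> I. fst p + \<alpha> (snd p) = s + \<alpha> i}. y s' * \<beta> i') = 0"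
    and s: "s \<in> R"
  shows "y s = 0"
proof (rule ccontr)
  assume "y s \<noteq> 0"
  \<comment> \<open>The leading term has to be taken within the support of \<open>y\<close>.\<close>
  define R' where "R' = {s \<in> R. y s \<noteq> 0}"
  have "finite R'" "R' \<noteq> {}" using fin s \<open>y s \<noteq> 0\<close> by (auto simp: R'_def)
  then obtain z where z: "z \<in> R'" "\<And>w. w \<in> R' \<Longrightarrow> Re w < Re z \<or> Re w = Re z \<and> Im w \<le> Im z"
    using lex_max_exists[of R'] by blast
  obtain i where i: "i \<in> I" "\<And>j. j \<in> I \<Longrightarrow>
      Re (\<alpha> j) < Re (\<alpha> i) \<or> Re (\<alpha> j) = Re (\<alpha> i) \<and> Im (\<alpha> j) \<le> Im (\<alpha> i)"
  proof -
    have "finite (\<alpha> ` I)" "\<alpha> ` I \<noteq> {}" using fin I by auto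
    from lex_max_exists[OF this] show ?thesis using that by blast
  qed
  define Q where "Q = {p \<in> R \<times> I. fst p + \<alpha> (snd p) = z + \<alpha> i}"
  have zi: "(z, i) \<in> Q" using z i by (auto simp: Q_def R'_def)
  have other: "y s' * \<beta> i' = 0" if "(s', i') \<in> Q - {(z, i)}" for s' i'
  proof (rule ccontr)
    assume "y s' * \<beta> i' \<noteq> 0"
    then have "s' \<in> R'" "i' \<in> I" and eq: "s' + \<alpha> i' = z + \<alpha> i"
      using that by (auto simp: R'_def Q_def)
    then have "Re s' + Re (\<alpha> i') = Re z + Re (\<alpha> i)" "Im s' + Im (\<alpha> i') = Im z + Im (\<alpha> i)"
      by (metis plus_complex.sel(1), metis plus_complex.sel(2))
    then have "s' = z" "\<alpha> i' = \<alpha> i"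
      using z(2)[OF \<open>s' \<in> R'\<close>] i(2)[OF \<open>i' \<in> I\<close>] by (auto simp: complex_eq_iff)
    then have "i' = i" using inj \<open>i' \<in> I\<close> i(1) by (auto simp: inj_on_def)
    then show False using that \<open>s' = z\<close> by simp
  qed
  have "0 = (\<Sum>(s', i')\<in>Q. y s' * \<beta> i')"
    unfolding Q_def using z i by (intro zero[symmetric]) (auto simp: R'_def)
  also have "\<dots> = y z * \<beta> i + (\<Sum>(s', i')\<in>Q - {(z, i)}. y s' * \<beta> i')"
    using fin zi by (subst sum.remove[of _ "(z, i)"]) (auto simp: Q_def)
  also have "(\<Sum>(s', i')\<in>Q - {(z, i)}. y s' * \<beta> i') = 0"
  proof (rule sum.neutral, rule ballI)
    fix p assume "p \<in> Q - {(z, i)}"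
    then show "(case p of (s', i') \<Rightarrow> y s' * \<beta> i') = 0"
      using other[of "fst p" "snd p"] by (simp add: case_prod_unfold)
  qed
  finally show False using z(1) \<beta>[OF i(1)] by (simp add: R'_def)
qed

text \<open>The sets \<open>S'\<close> and \<open>S\<close> stand for consecutive grids. An element
  of \<open>S\<close> may have several representations by the \<alpha> i, and a tuple that is not
  induced by a field embedding can give them different values; so \<rho> fixes one representation
  for all tuples.\<close>

locale exp_sum_approx =
  fixes V S S' :: "complex set" and m k n q :: nat and \<alpha> \<beta> :: "nat \<Rightarrow> complex"
    and \<rho> :: "complex \<Rightarrow> nat \<Rightarrow> nat" and A :: real
  assumes V: "finite V" "\<And>x. x \<in> V \<Longrightarrow> algebraic x"
    and \<alpha>V: "\<And>i. i \<in> {1..m} \<Longrightarrow> \<alpha> i \<in> V" and \<beta>V: "\<And>i. i \<in> {1..m} \<Longrightarrow> \<beta> i \<in> V"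
    and inj: "inj_on \<alpha> {1..m}" and \<beta>0: "\<And>i. i \<in> {1..m} \<Longrightarrow> \<beta> i \<noteq> 0"
    and m: "m \<ge> 1" and k: "k \<ge> 1"
    and S: "finite S" "S' \<subseteq> S" "S' \<noteq> {}"
    and S'S: "\<And>s i. s \<in> S' \<Longrightarrow> i \<in> {1..m} \<Longrightarrow> s + \<alpha> i \<in> S"
    and \<rho>: "\<And>\<gamma>. \<gamma> \<in> S \<Longrightarrow> \<gamma> = (\<Sum>i=1..m. of_nat (\<rho> \<gamma> i) * \<alpha> i)"
    and \<rho>_le: "\<And>\<gamma> i. \<gamma> \<in> S \<Longrightarrow> i \<in> {1..m} \<Longrightarrow> \<rho> \<gamma> i \<le> k"
    and q: "q \<ge> 1" "\<And>x. x \<in> V \<Longrightarrow> (\<lambda>t. of_nat q * t x) \<in> int_funs V"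
    and A: "A \<ge> 1" "\<And>t x. t \<in> conj_tuples V \<Longrightarrow> x \<in> V \<Longrightarrow> norm (t x) \<le> A"
begin

definition M where "M = card S"
definition M' where "M' = card S'"
text \<open>One exponent serves several purposes: it bounds the degree of \<open>fp t j\<close> for
  j < M, the number of factors \<open>q\<close> needed in \<open>Phi\<close>, and the exponent of
  \<open>2 * G\<close>.\<close>

definition w where "w = (n + 1) * M"
definition G where "G = real m * real k * A"
definition L where "L t \<gamma> = (\<Sum>i=1..m. of_nat (\<rho> \<gamma> i) * t (\<alpha> i))" for t :: "complex \<Rightarrow> complex"
text \<open>At tuples other than \<open>t0\<close> some of the roots may coincide. This is harmless,
  as distinct roots matter only for the nonvanishing at \<open>t0\<close>.\<close>

definition gp where "gp t = (\<Prod>\<gamma>\<in>S. [:- L t \<gamma>, 1:])"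
definition fp where "fp t j = monom 1 j * gp t ^ n"
definition Phi where "Phi t s j =
  (\<Sum>i=1..m. t (\<beta> i) * (lap (pcompose (fp t j) [:L t (s + \<alpha> i), 1:]) / fact n))"
definition \<Lambda> where "\<Lambda> = (\<Sum>i=1..m. \<beta> i * exp (\<alpha> i))"
definition t0 :: "complex \<Rightarrow> complex" where "t0 = restrict (\<lambda>x. x) V"

lemma G1: "G \<ge> 1"
proof -
  have "1 * 1 * 1 \<le> G" unfolding G_def using m k A by (intro mult_mono) auto
  then show ?thesis by simp
qed

lemma A0: "A \<ge> 0" using A by linarith

lemma M'1: "M' \<ge> 1" "M' \<le> M"
  using S finite_subset[OF S(2,1)] by (auto simp: M'_def M_def Suc_le_eq card_gt_0_iff intro: card_mono)

lemma t0: "t0 \<in> conj_tuples V" "x \<in> V \<Longrightarrow> t0 x = x"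
  using V by (auto simp: t0_def conj_tuples_def self_in_alg_conjs)

lemma L_t0: "\<gamma> \<in> S \<Longrightarrow> L t0 \<gamma> = \<gamma>"
proof -
  assume "\<gamma> \<in> S"
  have "L t0 \<gamma> = (\<Sum>i=1..m. of_nat (\<rho> \<gamma> i) * \<alpha> i)"
    unfolding L_def by (rule sum.cong) (use t0(2) \<alpha>V in auto)
  then show ?thesis using \<rho>[OF \<open>\<gamma> \<in> S\<close>] by simp
qed

lemma norm_L_le: "t \<in> conj_tuples V \<Longrightarrow> \<gamma> \<in> S \<Longrightarrow> norm (L t \<gamma>) \<le> G"
proof -
  assume t: "t \<in> conj_tuples V" "\<gamma> \<in> S"
  have "norm (L t \<gamma>) \<le> (\<Sum>i=1..m. real k * A)"
    unfolding L_def
    by (rule sum_norm_le) (use A0 t(2) in \<open>auto simp: norm_mult intro!: mult_mono A(2)[OF t(1)] \<alpha>V \<rho>_le\<close>)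
  then show ?thesis by (simp add: G_def)
qed

lemma L_int: "(\<lambda>t. of_nat q * L t \<gamma>) \<in> int_funs V"
proof -
  have "(\<lambda>t. \<Sum>i=1..m. of_nat (\<rho> \<gamma> i) * (of_nat q * t (\<alpha> i))) \<in> int_funs V"
    by (intro int_funs_sum int_funs_cmult_nat q \<alpha>V)
  then show ?thesis by (simp add: L_def sum_distrib_left mult_ac)
qed

text \<open>Shifting a root of order \<open>n\<close> to the origin exposes the factor
  \<open>monom 1 n\<close> that \<open>int_funs_lap\<close> requires.\<close>

lemma pcompose_fp:
  assumes "\<delta> \<in> S"
  shows "pcompose (fp t j) [:L t \<delta>, 1:] = monom 1 n *
    ([:L t \<delta>, 1:] ^ j * (\<Prod>\<gamma>\<in>S - {\<delta>}. [:L t \<delta> - L t \<gamma>, 1:]) ^ n)"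
proof -
  have pow: "pcompose (P ^ r) Q = pcompose P Q ^ r" for P Q :: "complex poly" and r
    by (induction r) (simp_all add: pcompose_mult pcompose_1)
  have "pcompose (monom 1 j) Q = Q ^ j" for Q :: "complex poly"
    by (simp add: monom_altdef pow pcompose_pCons)
  moreover have "pcompose (gp t) [:L t \<delta>, 1:] = (\<Prod>\<gamma>\<in>S. [:L t \<delta> - L t \<gamma>, 1:])"
    by (simp add: gp_def pcompose_prod pcompose_pCons)
  moreover have "\<dots> = monom 1 1 * (\<Prod>\<gamma>\<in>S - {\<delta>}. [:L t \<delta> - L t \<gamma>, 1:])"
    using assms S(1) by (subst prod.remove[of _ \<delta>]) (auto simp: monom_altdef)
  moreover have "monom 1 1 ^ n = (monom 1 n :: complex poly)"
    by (simp add: monom_altdef)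
  ultimately show ?thesis
    by (simp add: fp_def pcompose_mult pow power_mult_distrib mult_ac)
qed

lemma Phi_int:
  assumes s: "s \<in> S'" and j: "j < M"
  shows "(\<lambda>t. of_nat q ^ w * Phi t s j) \<in> int_funs V"
proof -
  have "(\<lambda>t. of_nat q ^ w * (t (\<beta> i) * (lap (pcompose (fp t j) [:L t (s + \<alpha> i), 1:]) / fact n)))
      \<in> int_funs V" if i: "i \<in> {1..m}" for i
  proof -
    define \<delta> where "\<delta> = s + \<alpha> i"
    have \<delta>: "\<delta> \<in> S" using S'S[OF s i] by (simp add: \<delta>_def)
    define P where "P = (\<lambda>t. [:L t \<delta>, 1:] ^ j * (\<Prod>\<gamma>\<in>S - {\<delta>}. [:L t \<delta> - L t \<gamma>, 1:]) ^ n)"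
    \<comment> \<open>\<open>j\<close> factors come from the power of the variable and
      \<open>n\<close> from each of the M - 1 other points; one more will be spent on
      \<open>t (\<beta> i)\<close>.\<close>
    define v where "v = j + n * (M - 1)"
    have card: "card (S - {\<delta>}) = M - 1" using \<delta> S(1) by (simp add: M_def)
    have "weighted_int V q (j * 1 + n * (card (S - {\<delta>}) * 1)) P"
      unfolding P_def
      using int_funs_diff[OF L_int[of \<delta>] L_int]
      by (intro weighted_int_mult weighted_int_power weighted_int_prod weighted_int_linear L_int)
        (simp add: right_diff_distrib)
    then have P: "weighted_int V q v P" by (simp add: v_def card)
    have deg: "degree (P t) \<le> v" for t
    proof -
      have "degree (\<Prod>\<gamma>\<in>S - {\<delta>}. [:L t \<delta> - L t \<gamma>, 1:]) \<le> M - 1"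
        using degree_prod_sum_le[of "S - {\<delta>}" "\<lambda>\<gamma>. [:L t \<delta> - L t \<gamma>, 1:]"] S(1)
        by (simp add: comp_def card)
      then have "degree ((\<Prod>\<gamma>\<in>S - {\<delta>}. [:L t \<delta> - L t \<gamma>, 1:]) ^ n) \<le> (M - 1) * n"
        using degree_power_le by (metis mult_le_mono1 order_trans)
      then show ?thesis
        unfolding P_def v_def by (intro order_trans[OF degree_mult_le])
          (simp add: degree_linear_power mult.commute)
    qed
    have "(\<lambda>t. (of_nat q * t (\<beta> i)) * (of_nat q ^ v * (lap (monom 1 n * P t) / fact n))) \<in> int_funs V"
      by (intro int_funs.mult int_funs_lap[OF P deg] q \<beta>V i)
    then have "(\<lambda>t. of_nat q ^ Suc v * (t (\<beta> i) * (lap (monom 1 n * P t) / fact n))) \<in> int_funs V"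
      by (simp add: mult_ac)
    moreover have "Suc v \<le> w"
    proof -
      have "n * (M - 1) \<le> n * M" by simp
      then show ?thesis using j unfolding v_def w_def by (simp add: algebra_simps)
    qed
    ultimately have "(\<lambda>t. of_nat q ^ w * (t (\<beta> i) * (lap (monom 1 n * P t) / fact n))) \<in> int_funs V"
      by (rule int_funs_weight_mono)
    then show ?thesis
      by (simp add: pcompose_fp[OF \<delta>, unfolded \<delta>_def] P_def \<delta>_def)
  qed
  then show ?thesis unfolding Phi_def sum_distrib_left by (rule int_funs_sum)
qed

text \<open>At \<open>t0\<close> this is \<open>exp s * \<Lambda>\<close>. At other tuples
  \<open>L t\<close> need not be additive, so no common exponential can be taken out.\<close>

definition lin where "lin t s = (\<Sum>i=1..m. t (\<beta> i) * exp (L t (s + \<alpha> i)))" for t :: "complex \<Rightarrow> complex"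

section \<open>Size of the matrix entries\<close>

lemma majorizes_fp:
  assumes "t \<in> conj_tuples V"
  shows "majorizes (monom 1 j * [:G, 1:] ^ (M * n)) (fp t j)"
proof -
  have "majorizes (\<Prod>\<gamma>\<in>S. [:G, 1:]) (gp t)"
    unfolding gp_def using norm_L_le[OF assms] by (intro majorizes_prod majorizes_linear) auto
  then have "majorizes ([:G, 1:] ^ M) (gp t)" by (simp add: M_def)
  then show ?thesis unfolding fp_def power_mult
    by (intro majorizes_mult majorizes_monom majorizes_power)
qed

lemma poly_majorant_le:
  assumes "j < M" "1 \<le> r" "r \<le> G"
  shows "poly (monom 1 j * [:G, 1:] ^ (M * n)) r \<le> (2 * G) ^ w"
proof -
  have "poly (monom 1 j * [:G, 1:] ^ (M * n)) r = r ^ j * (G + r) ^ (M * n)"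
    by (simp add: poly_monom)
  also have "\<dots> \<le> (2 * G) ^ j * (2 * G) ^ (M * n)"
    using assms G1 by (intro mult_mono power_mono) auto
  also have "\<dots> = (2 * G) ^ (j + M * n)" by (simp add: power_add)
  also have "\<dots> \<le> (2 * G) ^ w"
    using assms G1 by (intro power_increasing) (auto simp: w_def)
  finally show ?thesis .
qed

lemma degree_fp: "j < M \<Longrightarrow> degree (fp t j) \<le> w"
proof -
  assume j: "j < M"
  have "degree (gp t) \<le> M"
    unfolding gp_def using degree_prod_sum_le[OF S(1), of "\<lambda>\<gamma>. [:- L t \<gamma>, 1:]"]
    by (simp add: comp_def M_def)
  then have "degree (gp t ^ n) \<le> M * n"
    using degree_power_le by (metis mult_le_mono1 order_trans)
  then have "degree (fp t j) \<le> j + M * n"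
    unfolding fp_def by (intro order_trans[OF degree_mult_le] add_mono degree_monom_le)
  then show ?thesis using j by (simp add: w_def mult.commute)
qed

lemma norm_lap_fp_le:
  assumes "t \<in> conj_tuples V" "j < M"
  shows "norm (lap (fp t j)) \<le> fact w * (2 * G) ^ w"
proof -
  have "norm (lap (fp t j)) \<le> fact w * poly (monom 1 j * [:G, 1:] ^ (M * n)) 1"
    by (rule norm_lap_le[OF majorizes_fp[OF assms(1)] degree_fp[OF assms(2)]])
  also have "\<dots> \<le> fact w * (2 * G) ^ w"
    using poly_majorant_le[OF assms(2), of 1] G1 by (intro mult_left_mono) auto
  finally show ?thesis .
qed

text \<open>The subtracted term is a function of \<open>s\<close> times a function of
  \<open>j\<close>: \<open>Phi t\<close> is a rank-one matrix up to an error without the factor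
  \<open>fact w\<close>.\<close>

lemma Phi_approx:
  assumes t: "t \<in> conj_tuples V" and s: "s \<in> S'" and j: "j < M"
  shows "norm (Phi t s j - lin t s * (lap (fp t j) / fact n)) \<le> m * A * exp G * (2 * G) ^ w / fact n"
proof -
  define err where "err = (\<lambda>c. exp c * lap (fp t j) - lap (pcompose (fp t j) [:c, 1:]))"
  have err: "norm (err (L t \<gamma>)) \<le> exp G * (2 * G) ^ w" if "\<gamma> \<in> S" for \<gamma>
  proof -
    define c where "c = L t \<gamma>"
    have c: "norm c \<le> G" using norm_L_le[OF t that] by (simp add: c_def)
    have "norm (err c) \<le> exp (norm c) * (\<Sum>i\<le>degree (fp t j). norm (coeff (fp t j) i) * norm c ^ i)"
      unfolding err_def by (rule lap_shift_approx)
    also have "\<dots> \<le> exp G * (\<Sum>i\<le>degree (fp t j). norm (coeff (fp t j) i) * G ^ i)"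
      using c by (intro mult_mono sum_mono power_mono sum_nonneg) auto
    also have "\<dots> \<le> exp G * poly (monom 1 j * [:G, 1:] ^ (M * n)) G"
      using G1 by (intro mult_left_mono majorizes_sum_le majorizes_fp t) auto
    also have "\<dots> \<le> exp G * (2 * G) ^ w"
      using G1 by (intro mult_left_mono poly_majorant_le j) auto
    finally show ?thesis by (simp add: c_def)
  qed
  have "Phi t s j - lin t s * (lap (fp t j) / fact n) =
      (\<Sum>i=1..m. t (\<beta> i) * (- err (L t (s + \<alpha> i)) / fact n))"
    unfolding Phi_def lin_def err_def sum_distrib_right sum_subtractf[symmetric]
    by (intro sum.cong) (auto simp: field_simps)
  also have "norm \<dots> \<le> (\<Sum>i=1..m. A * (exp G * (2 * G) ^ w / fact n))"
  proof (rule sum_norm_le)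
    fix i assume i: "i \<in> {1..m}"
    have "norm (t (\<beta> i) * (- err (L t (s + \<alpha> i)) / fact n)) =
        norm (t (\<beta> i)) * (norm (err (L t (s + \<alpha> i))) / fact n)"
      by (simp add: norm_mult norm_divide)
    also have "\<dots> \<le> A * (exp G * (2 * G) ^ w / fact n)"
      using A0 by (intro mult_mono divide_right_mono A t \<beta>V i err S'S s) auto
    finally show "norm (t (\<beta> i) * (- err (L t (s + \<alpha> i)) / fact n)) \<le> A * (exp G * (2 * G) ^ w / fact n)" .
  qed
  finally show ?thesis by (simp add: mult_ac)
qed

lemma norm_lin_le:
  assumes t: "t \<in> conj_tuples V" and s: "s \<in> S'"
  shows "norm (lin t s) \<le> m * A * exp G"
proof -
  have "norm (lin t s) \<le> (\<Sum>i=1..m. A * exp G)"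
    unfolding lin_def
  proof (rule sum_norm_le)
    fix i assume i: "i \<in> {1..m}"
    have "norm (exp (L t (s + \<alpha> i))) \<le> exp (norm (L t (s + \<alpha> i)))" by (rule norm_exp)
    also have "\<dots> \<le> exp G" using norm_L_le[OF t S'S[OF s i]] by simp
    finally show "norm (t (\<beta> i) * exp (L t (s + \<alpha> i))) \<le> A * exp G"
      unfolding norm_mult using A0 by (intro mult_mono A t \<beta>V i) auto
  qed
  then show ?thesis by simp
qed

text \<open>The constant agrees with that of \<open>norm_lin_le\<close>, so that one determinant
  estimate covers both cases.\<close>

lemma norm_lin_t0_le:
  assumes s: "s \<in> S'"
  shows "norm (lin t0 s) \<le> m * A * exp G * norm \<Lambda>"
proof -
  have "lin t0 s = exp s * \<Lambda>"
    unfolding lin_def \<Lambda>_def sum_distrib_left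
    by (intro sum.cong) (auto simp: t0 \<beta>V L_t0 S'S s exp_add)
  moreover have "norm s \<le> G" using norm_L_le[OF t0(1), of s] L_t0[of s] s S(2) by auto
  then have "norm (exp s) \<le> exp G" using norm_exp[of s] by (smt (verit) exp_le_cancel_iff)
  moreover have "1 * exp G \<le> (m * A) * exp G"
    using m A mult_mono[of 1 "real m" 1 A] by (intro mult_right_mono) auto
  ultimately have "lin t0 s = exp s * \<Lambda>" "norm (exp s) \<le> m * A * exp G" by linarith+
  then show ?thesis by (simp only: norm_mult mult_right_mono norm_ge_zero)
qed

text \<open>A relation between the rows, with coefficients \<open>y\<close>, yields a relation
  between the Hermite functionals at the points of \<open>S\<close>. Its coefficients are the
  product of \<open>y\<close> and \<beta> in the group algebra; they vanish by
  \<open>hermite_nonvanishing\<close>, and then so does \<open>y\<close>.\<close>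

lemma minor_nonzero:
  assumes \<sigma>: "bij_betw \<sigma> {..<M'} S'"
  shows "\<exists>J. (\<forall>b<M'. J b < M) \<and> det (mat M' M' (\<lambda>(a, b). Phi t0 (\<sigma> a) (J b))) \<noteq> 0"
proof -
  have "c a = 0"
    if c: "\<And>j. j \<in> {..<M} \<Longrightarrow> (\<Sum>a<M'. c a * Phi t0 (\<sigma> a) j) = 0" and a: "a < M'" for c a
  proof -
    define y where "y = (\<lambda>s. c (the_inv_into {..<M'} \<sigma> s))"
    have y: "y (\<sigma> a) = c a" if "a < M'" for a
      using \<sigma> that by (simp add: y_def bij_betw_def the_inv_into_f_f)
    have finS': "finite S'" using S finite_subset by blast
    define x where "x = (\<lambda>\<gamma>. \<Sum>(s, i)\<in>{p \<in> S' \<times> {1..m}. fst p + \<alpha> (snd p) = \<gamma>}. y s * \<beta> i)"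
    have "(\<Sum>\<gamma>\<in>S. x \<gamma> * lap (pcompose (monom 1 j * (\<Prod>\<gamma>\<in>S. [:- \<gamma>, 1:]) ^ n) [:\<gamma>, 1:])) = 0"
      if j: "j < card S" for j
    proof -
      define T where "T = (\<lambda>\<gamma>. lap (pcompose (fp t0 j) [:\<gamma>, 1:]))"
      have gp: "(\<Prod>\<gamma>\<in>S. [:- \<gamma>, 1:]) = gp t0"
        unfolding gp_def by (rule prod.cong) (simp_all add: L_t0)
      have "(\<Sum>\<gamma>\<in>S. x \<gamma> * T \<gamma>) =
          (\<Sum>\<gamma>\<in>S. \<Sum>p\<in>{p \<in> S' \<times> {1..m}. fst p + \<alpha> (snd p) = \<gamma>}.
             y (fst p) * \<beta> (snd p) * T (fst p + \<alpha> (snd p)))"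
        by (intro sum.cong refl) (auto simp: x_def sum_distrib_right case_prod_unfold intro!: sum.cong)
      also have "\<dots> = (\<Sum>p\<in>S' \<times> {1..m}. y (fst p) * \<beta> (snd p) * T (fst p + \<alpha> (snd p)))"
        by (rule sum.group) (use S finS' S'S in auto)
      also have "\<dots> = (\<Sum>s\<in>S'. y s * (\<Sum>i=1..m. \<beta> i * T (s + \<alpha> i)))"
        by (subst sum.Sigma[symmetric, of S' "\<lambda>_. {1..m}" "\<lambda>s i. y s * \<beta> i * T (s + \<alpha> i)", unfolded case_prod_unfold])
          (use finS' in \<open>auto simp: sum_distrib_left mult_ac\<close>)
      also have "\<dots> = (\<Sum>s\<in>S'. y s * (fact n * Phi t0 s j))"
      proof (rule sum.cong[OF refl])
        fix s assume s: "s \<in> S'"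
        have "fact n * Phi t0 s j = (\<Sum>i=1..m. \<beta> i * T (s + \<alpha> i))"
          unfolding Phi_def sum_distrib_left
        proof (rule sum.cong[OF refl])
          fix i assume i: "i \<in> {1..m}"
          show "fact n * (t0 (\<beta> i) * (lap (pcompose (fp t0 j) [:L t0 (s + \<alpha> i), 1:]) / fact n)) =
              \<beta> i * T (s + \<alpha> i)"
            using L_t0[OF S'S[OF s i]] t0(2)[OF \<beta>V[OF i]] by (simp add: T_def)
        qed
        then show "y s * (\<Sum>i=1..m. \<beta> i * T (s + \<alpha> i)) = y s * (fact n * Phi t0 s j)" by simp
      qed
      also have "\<dots> = (\<Sum>a<M'. y (\<sigma> a) * (fact n * Phi t0 (\<sigma> a) j))"
        by (rule sum.reindex_bij_betw[OF \<sigma>, symmetric])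
      also have "\<dots> = fact n * (\<Sum>a<M'. c a * Phi t0 (\<sigma> a) j)"
        by (simp add: y sum_distrib_left mult_ac)
      also have "\<dots> = 0" using c[of j] j by (simp add: M_def)
      finally show ?thesis by (simp add: T_def fp_def gp)
    qed
    then have x0: "x \<gamma> = 0" if "\<gamma> \<in> S" for \<gamma>
      using hermite_nonvanishing[OF S(1) _ that] by blast
    have "y (\<sigma> a) = 0"
      by (rule group_algebra_no_zero_divisor[of S' "{1..m}" \<alpha> \<beta> y])
        (use finS' m inj \<beta>0 x0 S'S \<sigma> a in \<open>auto simp: x_def bij_betw_def\<close>)
    then show ?thesis using y[OF a] by simp
  qed
  then have "\<exists>J. (\<forall>b<M'. J b \<in> {..<M}) \<and> det (mat M' M' (\<lambda>(a, b). Phi t0 (\<sigma> a) (J b))) \<noteq> 0"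
    by (rule exists_nonzero_minor)
  then show ?thesis by auto
qed

text \<open>\<open>X / fact n\<close> is the error bound of \<open>Phi_approx\<close> after clearing
  denominators.\<close>

definition X where "X = real q ^ w * (m * A * exp G * (2 * G) ^ w)"

lemma X1: "X \<ge> 1"
proof -
  have "1 * (1 * 1 * 1 * 1) \<le> X"
    unfolding X_def using q m A G1 by (intro mult_mono one_le_power) auto
  then show ?thesis by simp
qed

text \<open>Liouville's inequality for the cleared minor. \<open>Y\<close> bounds its value at every
  tuple and, being at least 1, may be raised to \<delta> - 1 although fewer tuples can contribute;
  the last factor is the sharper bound at \<open>t0\<close>.\<close>

lemma core_inequality:
  assumes \<delta>: "card (conj_tuples V) \<le> \<delta>"
    and Y: "fact (Suc M') * ((fact w + 1) * (X / fact n) ^ M') \<le> Y" "1 \<le> Y"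
  shows "1 \<le> Y ^ (\<delta> - 1) * (fact (Suc M') * ((fact w * norm \<Lambda> + 1) * (X / fact n) ^ M'))"
proof -
  have "finite S'" using S finite_subset by blast
  then obtain \<sigma> where \<sigma>: "bij_betw \<sigma> {..<M'} S'"
    using ex_bij_betw_nat_finite[of S'] by (auto simp: M'_def lessThan_atLeast0)
  obtain J where J: "\<And>b. b < M' \<Longrightarrow> J b < M"
    and det: "det (mat M' M' (\<lambda>(a, b). Phi t0 (\<sigma> a) (J b))) \<noteq> 0"
    using minor_nonzero[OF \<sigma>] by blast
  have \<sigma>S: "\<sigma> a \<in> S'" if "a < M'" for a using \<sigma> that by (auto simp: bij_betw_def)
  define F where "F = (\<lambda>t. det (mat M' M' (\<lambda>(a, b). of_nat q ^ w * Phi t (\<sigma> a) (J b))))"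
  have F_int: "F \<in> int_funs V"
    unfolding F_def by (intro int_funs_det Phi_int \<sigma>S J)
  have "mat M' M' (\<lambda>(a, b). of_nat q ^ w * Phi t0 (\<sigma> a) (J b)) =
      of_nat q ^ w \<cdot>\<^sub>m mat M' M' (\<lambda>(a, b). Phi t0 (\<sigma> a) (J b))"
    by (intro eq_matI) auto
  then have F0: "F t0 \<noteq> 0" using det q by (simp add: F_def)
  define \<epsilon> where "\<epsilon> = X / fact n"
  have \<epsilon>: "\<epsilon> > 0" using X1 by (simp add: \<epsilon>_def)
  have bound: "norm (F t) \<le> fact (Suc M') * ((fact w * c + 1) * \<epsilon> ^ M')"
    if t: "t \<in> conj_tuples V" and c: "c \<ge> 0" "\<And>s. s \<in> S' \<Longrightarrow> norm (lin t s) \<le> m * A * exp G * c" for t c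
  proof -
    define v where "v = (\<lambda>b. of_nat q ^ w * (lap (fp t (J b)) / fact n))"
    define e where "e = (\<lambda>a b. of_nat q ^ w * (Phi t (\<sigma> a) (J b) - lin t (\<sigma> a) * (lap (fp t (J b)) / fact n)))"
    have F: "F t = det (mat M' M' (\<lambda>(a, b). lin t (\<sigma> a) * v b + e a b))"
    proof -
      have "of_nat q ^ w * Phi t (\<sigma> a) (J b) = lin t (\<sigma> a) * v b + e a b" for a b
        unfolding v_def e_def right_diff_distrib by (simp only: mult.left_commute) simp
      then show ?thesis by (simp only: F_def)
    qed
    \<comment> \<open>The summand \<open>1 / fact w\<close> ensures \<epsilon> \<le> U W even when
      \<open>c\<close> is 0, as \<Lambda> is not yet known to be nonzero.\<close>
    define U where "U = m * A * exp G * (c + 1 / fact w)"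
    define W where "W = real q ^ w * (fact w * (2 * G) ^ w / fact n)"
    have UW: "U * W = (fact w * c + 1) * \<epsilon>"
    proof -
      have "U * W = ((c + 1 / fact w) * fact w) * \<epsilon>"
        unfolding U_def W_def \<epsilon>_def X_def
        by (simp only: mult_ac times_divide_eq_right times_divide_eq_left)
      also have "(c + 1 / fact w) * fact w = fact w * c + 1" by (simp add: distrib_right)
      finally show ?thesis .
    qed
    have e_le: "norm (e a b) \<le> \<epsilon>" if "a < M'" "b < M'" for a b
    proof -
      have "norm (e a b) \<le> real q ^ w * (m * A * exp G * (2 * G) ^ w / fact n)"
        unfolding e_def norm_mult norm_power norm_of_nat
        by (intro mult_left_mono Phi_approx t \<sigma>S J that) simp
      then show ?thesis by (simp add: \<epsilon>_def X_def)
    qed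
    have u_le: "norm (lin t (\<sigma> a)) \<le> U" if "a < M'" for a
    proof -
      have "norm (lin t (\<sigma> a)) \<le> m * A * exp G * c" by (rule c) (rule \<sigma>S[OF that])
      also have "\<dots> \<le> U" unfolding U_def using A0 by (intro mult_left_mono) auto
      finally show ?thesis .
    qed
    have v_le: "norm (v b) \<le> W" if "b < M'" for b
      unfolding v_def W_def norm_mult norm_divide norm_power norm_of_nat norm_fact
      by (intro mult_left_mono divide_right_mono norm_lap_fp_le t J that) simp_all
    have "norm (F t) * \<epsilon> \<le> fact (Suc M') * (U * W * \<epsilon> ^ M')"
      unfolding F
    proof (rule norm_det_rank_one_update_le)
      show "\<epsilon> \<le> U * W" unfolding UW using \<epsilon> c by (simp add: algebra_simps)
      show "U \<ge> 0" "W \<ge> 0" using A0 G1 c by (auto simp: U_def W_def)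
    qed (use e_le u_le v_le \<epsilon> in auto)
    also have "\<dots> = (fact (Suc M') * ((fact w * c + 1) * \<epsilon> ^ M')) * \<epsilon>"
      unfolding UW by (simp add: algebra_simps)
    finally show ?thesis using \<epsilon> by simp
  qed
  define T where "T = {t \<in> conj_tuples V. F t \<noteq> 0}"
  have fin: "finite (conj_tuples V)"
    using V finite_alg_conjs by (auto simp: conj_tuples_def intro!: finite_PiE)
  then have T: "finite T" "t0 \<in> T" using t0 F0 by (auto simp: T_def)
  have "card T \<le> \<delta>" using card_mono[OF fin, of T] \<delta> by (auto simp: T_def)
  have "norm (F t) \<le> Y" if "t \<in> T" for t
    using bound[of t 1] norm_lin_le[of t] Y that by (auto simp: T_def \<epsilon>_def)
  then have "(\<Prod>t\<in>T - {t0}. norm (F t)) \<le> (\<Prod>t\<in>T - {t0}. Y)"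
    by (intro prod_mono) auto
  also have "\<dots> = Y ^ (card T - 1)" using T by simp
  also have "\<dots> \<le> Y ^ (\<delta> - 1)"
    using \<open>card T \<le> \<delta>\<close> Y(2) by (intro power_increasing) auto
  finally have prod_le: "(\<Prod>t\<in>T - {t0}. norm (F t)) \<le> Y ^ (\<delta> - 1)" .
  have F0_le: "norm (F t0) \<le> fact (Suc M') * ((fact w * norm \<Lambda> + 1) * \<epsilon> ^ M')"
    by (rule bound) (use t0 norm_lin_t0_le in auto)
  have "1 \<le> (\<Prod>t\<in>T. norm (F t))"
    unfolding T_def by (rule int_fun_liouville[OF V F_int])
  also have "\<dots> = (\<Prod>t\<in>T - {t0}. norm (F t)) * norm (F t0)"
    using prod.remove[OF T, of "\<lambda>t. norm (F t)"] by (simp add: mult.commute)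
  also have "\<dots> \<le> Y ^ (\<delta> - 1) * (fact (Suc M') * ((fact w * norm \<Lambda> + 1) * \<epsilon> ^ M'))"
    using Y(2) by (intro mult_mono prod_le F0_le prod_nonneg) auto
  finally show ?thesis by (simp add: \<epsilon>_def)
qed

end

section \<open>Choice of the parameters\<close>

definition grid :: "nat \<Rightarrow> (nat \<Rightarrow> complex) \<Rightarrow> nat \<Rightarrow> complex set" where
  "grid m \<alpha> k = (\<lambda>e. \<Sum>i=1..m. of_nat (e i) * \<alpha> i) ` (PiE {1..m} (\<lambda>_. {..k}))"

lemma finite_grid: "finite (grid m \<alpha> k)"
  unfolding grid_def by (intro finite_imageI finite_PiE) auto

lemma card_grid_le: "card (grid m \<alpha> k) \<le> (k + 1) ^ m"
proof -
  have "card (grid m \<alpha> k) \<le> card (PiE {1..m} (\<lambda>_. {..k}))"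
    unfolding grid_def by (intro card_image_le finite_PiE) auto
  then show ?thesis by (simp add: card_PiE)
qed

lemma grid_nonempty: "grid m \<alpha> k \<noteq> {}"
  unfolding grid_def by (auto simp: PiE_eq_empty_iff)

lemma grid_mono: "k \<le> l \<Longrightarrow> grid m \<alpha> k \<subseteq> grid m \<alpha> l"
  unfolding grid_def by (intro image_mono PiE_mono) auto

lemma grid_step:
  assumes s: "s \<in> grid m \<alpha> k" and i: "i \<in> {1..m}"
  shows "s + \<alpha> i \<in> grid m \<alpha> (Suc k)"
proof -
  obtain e where e: "e \<in> PiE {1..m} (\<lambda>_. {..k})" "s = (\<Sum>j=1..m. of_nat (e j) * \<alpha> j)"
    using s by (auto simp: grid_def)
  define e' where "e' = e(i := Suc (e i))"
  have "e' \<in> PiE {1..m} (\<lambda>_. {..Suc k})"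
    using e(1) i by (auto simp: e'_def PiE_iff extensional_def le_SucI)
  moreover have "(\<Sum>j=1..m. of_nat (e' j) * \<alpha> j) = s + \<alpha> i"
  proof -
    have "(\<Sum>j\<in>{1..m} - {i}. of_nat (e' j) * \<alpha> j) = (\<Sum>j\<in>{1..m} - {i}. of_nat (e j) * \<alpha> j)"
      by (rule sum.cong) (auto simp: e'_def)
    moreover have "(\<Sum>j=1..m. of_nat (f j) * \<alpha> j) =
        of_nat (f i) * \<alpha> i + (\<Sum>j\<in>{1..m} - {i}. of_nat (f j) * \<alpha> j)" for f
      using i by (intro sum.remove) auto
    ultimately show ?thesis
      unfolding e(2) by (simp add: e'_def algebra_simps)
  qed
  ultimately show ?thesis unfolding grid_def by (intro image_eqI[of _ _ e']) auto
qed

text \<open>Otherwise every step multiplies \<open>c\<close> by at least 1 + 1/a, with a =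
  2(\<delta>-1), and exponential growth overtakes the polynomial bound. For \<delta> = 1 the growth
  condition is trivial.\<close>

lemma exists_slow_growth:
  fixes c :: "nat \<Rightarrow> nat"
  assumes c0: "c 0 \<ge> 1" and mono: "\<And>k. c k \<le> c (Suc k)" and le: "\<And>k. c k \<le> (k + 1) ^ m"
    and m: "m \<ge> 1" and \<delta>: "\<delta> = 1 \<or> \<delta> \<ge> 2 \<and> m \<le> \<delta>"
  shows "\<exists>k. Suc k \<le> 16 * \<delta> ^ 3 \<and> c (Suc k) \<le> (17 * \<delta> ^ 3) ^ m \<and>
    2 * ((\<delta> - 1) * (c (Suc k) - c k)) \<le> c k"
proof (cases "\<delta> = 1")
  case True
  have "c (Suc 0) \<le> (Suc 0 + 1) ^ m" by (rule le)
  also have "\<dots> \<le> 17 ^ m" by (intro power_mono) auto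
  finally show ?thesis using True by (intro exI[of _ 0]) auto
next
  case False
  then have \<delta>: "\<delta> \<ge> 2" "m \<le> \<delta>" using \<delta> by auto
  define a where "a = 2 * (\<delta> - 1)"
  \<comment> \<open>By Bernoulli, \<open>a\<close> steps at least double \<open>c\<close>, so
    \<open>K\<close> steps double it 8 \<delta> m times, beyond the bound (17 \<delta>^3)^m. The 17
    is 16 + 1, from K + 1.\<close>
  define K where "K = a * (8 * \<delta> * m)"
  have a: "a > 0" using \<delta> by (simp add: a_def)
  have K: "K \<le> 16 * \<delta> ^ 3"
  proof -
    have "a * (8 * \<delta> * m) \<le> (2 * \<delta>) * (8 * \<delta> * \<delta>)"
      using \<delta> by (intro mult_le_mono) (auto simp: a_def)
    then show ?thesis by (simp add: K_def power3_eq_cube mult_ac)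
  qed
  have small: "c k \<le> (17 * \<delta> ^ 3) ^ m" if "k \<le> K" for k
  proof -
    have "c k \<le> (k + 1) ^ m" by (rule le)
    also have "\<dots> \<le> (17 * \<delta> ^ 3) ^ m"
    proof (rule power_mono)
      have "1 \<le> \<delta> ^ 3" using \<delta> by simp
      then show "k + 1 \<le> 17 * \<delta> ^ 3" using that K by linarith
    qed simp
    finally show ?thesis .
  qed
  show ?thesis
  proof (rule ccontr)
    assume no_k: "\<not> ?thesis"
    have grow: "c k < a * (c (Suc k) - c k)" if "Suc k \<le> K" for k
    proof -
      have "Suc k \<le> 16 * \<delta> ^ 3" using that K by linarith
      then have "\<not> 2 * ((\<delta> - 1) * (c (Suc k) - c k)) \<le> c k"
        using no_k small[OF that] by blast
      then show ?thesis by (simp add: a_def mult.assoc)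
    qed
    have "(1 + 1 / real a) ^ k \<le> real (c k)" if "k \<le> K" for k
      using that
    proof (induction k)
      case (Suc k)
      have "real (c k) \<le> real (a * (c (Suc k) - c k))"
        using grow[OF Suc.prems] by (simp only: of_nat_le_iff less_imp_le)
      also have "\<dots> = real a * (real (c (Suc k)) - real (c k))"
        using mono[of k] by (simp add: of_nat_diff)
      finally have "real (c k) / real a \<le> real (c (Suc k)) - real (c k)"
        using a by (simp add: pos_divide_le_eq mult.commute)
      moreover have "(1 + 1 / real a) * real (c k) = real (c k) + real (c k) / real a"
        by (simp add: distrib_right)
      ultimately have "(1 + 1 / real a) * real (c k) \<le> real (c (Suc k))" by linarith
      moreover have "(1 + 1 / real a) * (1 + 1 / real a) ^ k \<le> (1 + 1 / real a) * real (c k)"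
        using Suc by (intro mult_left_mono) auto
      ultimately show ?case by simp
    qed (use c0 in simp)
    then have "(1 + 1 / real a) ^ K \<le> real (c K)" by simp
    moreover have "(2 :: real) ^ (8 * \<delta> * m) \<le> (1 + 1 / real a) ^ K"
    proof -
      have "2 \<le> (1 + 1 / real a) ^ a"
      proof -
        have "- 1 \<le> 1 / real a" by (rule order_trans[of _ 0]) auto
        then show ?thesis using Bernoulli_inequality[of "1 / real a" a] a by simp
      qed
      then show ?thesis
        unfolding K_def power_mult by (intro power_mono) auto
    qed
    moreover have "real (c K) < 2 ^ (8 * \<delta> * m)"
    proof -
      have "\<delta> + 1 \<le> 2 ^ \<delta>" by (simp add: Suc_leI)
      have "\<delta> ^ 3 \<le> (\<delta> + 1) ^ 3" "1 \<le> (\<delta> + 1) ^ 3" by (rule power_mono, simp_all)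
      moreover have "17 * x < 3 ^ 5 * y" if "x \<le> y" "1 \<le> y" for x y :: nat
        using that by simp
      ultimately have "17 * \<delta> ^ 3 < 3 ^ 5 * (\<delta> + 1) ^ 3" by blast
      also have "\<dots> \<le> (\<delta> + 1) ^ 5 * (\<delta> + 1) ^ 3"
        using \<delta> by (intro mult_le_mono1 power_mono) simp_all
      also have "\<dots> = (\<delta> + 1) ^ (5 + 3)" by (rule power_add[symmetric])
      also have "\<dots> \<le> (2 ^ \<delta>) ^ (5 + 3)" using \<open>\<delta> + 1 \<le> 2 ^ \<delta>\<close> by (rule power_mono) simp
      also have "\<dots> = 2 ^ (8 * \<delta>)" by (simp add: power_mult[symmetric] mult.commute)
      finally have "(17 * \<delta> ^ 3) ^ m < (2 ^ (8 * \<delta>)) ^ m"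
        using m by (intro power_strict_mono) simp_all
      then have "c K < 2 ^ (8 * \<delta> * m)"
        using small[of K] by (simp add: power_mult)
      then have "real (c K) < real (2 ^ (8 * \<delta> * m))" by (simp only: of_nat_less_iff)
      then show ?thesis by simp
    qed
    ultimately show False by linarith
  qed
qed

text \<open>A bound for the multinomial coefficient (ab)!/(a!)^b; it serves to compare w! with a
  power of n!.\<close>

lemma fact_mult_le: "fact (a * b) \<le> b ^ (a * b) * (fact a :: nat) ^ b"
proof (induction a)
  case (Suc a)
  have *: "fact (x + y) \<le> fact x * (x + y) ^ y" for x y :: nat
  proof (induction y)
    case (Suc y)
    have "fact (x + Suc y) = (x + Suc y) * fact (x + y)" by simp
    also have "\<dots> \<le> (x + Suc y) * (fact x * (x + y) ^ y)" using Suc by (intro mult_le_mono2)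
    also have "\<dots> \<le> (x + Suc y) * (fact x * (x + Suc y) ^ y)"
      by (intro mult_le_mono2 power_mono) auto
    finally show ?case by (simp add: mult_ac)
  qed simp
  have "fact (Suc a * b) = (fact (a * b + b) :: nat)" by (simp add: add.commute)
  also have "\<dots> \<le> fact (a * b) * (a * b + b) ^ b" by (rule *)
  also have "\<dots> \<le> (b ^ (a * b) * fact a ^ b) * (a * b + b) ^ b"
    using Suc by (rule mult_le_mono1)
  also have "(a * b + b) ^ b = (Suc a * b) ^ b" by (simp add: add.commute)
  also have "(b ^ (a * b) * fact a ^ b) * \<dots> = b ^ (Suc a * b) * (fact (Suc a) :: nat) ^ b"
  proof -
    have "(Suc a * b) ^ b = Suc a ^ b * b ^ b" by (rule power_mult_distrib)
    moreover have "b ^ (Suc a * b) = b ^ b * b ^ (a * b)" by (simp add: power_add)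
    moreover have "(fact (Suc a) :: nat) ^ b = Suc a ^ b * fact a ^ b"
      by (simp only: fact_Suc of_nat_id power_mult_distrib)
    ultimately show ?thesis by (simp only: mult_ac)
  qed
  finally show ?case .
qed simp

text \<open>The left side is \<open>fact n\<close> times a single term of the series of
  \<open>exp (real n)\<close>.\<close>

lemma power_le_fact_exp: "real n ^ n \<le> fact n * exp (real n)"
proof -
  have "real n ^ n / fact n \<le> exp (real n)"
  proof -
    have s: "(\<lambda>k. real n ^ k / fact k) sums exp (real n)"
      using exp_converges[of "real n"] by (simp add: field_simps)
    have "(\<Sum>k\<in>{n}. real n ^ k / fact k) \<le> (\<Sum>k. real n ^ k / fact k)"
      by (rule sum_le_suminf) (use s in \<open>auto simp: sums_iff\<close>)
    then show ?thesis using s by (simp add: sums_iff)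
  qed
  then show ?thesis by (simp add: field_simps)
qed

context exp_sum_approx
begin

text \<open>Collects all factors that grow at most exponentially in \<open>n\<close>, so that only
  powers of \<open>fact n\<close> remain to be compared.\<close>

definition Z where "Z = 2 * fact (Suc M') * X ^ M' * (real M ^ w * (real n + 1) ^ M)"

lemma fact_w_le: "fact w \<le> real M ^ w * (real n + 1) ^ M * fact n ^ M"
proof -
  have "real (fact w) \<le> real (M ^ w * fact (n + 1) ^ M)"
    unfolding w_def using fact_mult_le[of "n + 1" M] by (simp only: of_nat_le_iff)
  moreover have "real (fact (n + 1)) = (real n + 1) * fact n" by (simp add: algebra_simps)
  ultimately show ?thesis by (simp only: of_nat_mult of_nat_power of_nat_fact power_mult_distrib mult.assoc)
qed

lemma Z1: "Z \<ge> 1"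
proof -
  have "1 * 1 * 1 * (1 * 1) \<le> Z"
    unfolding Z_def using X1 M'1 by (intro mult_mono one_le_power) (auto simp del: fact_Suc)
  then show ?thesis by simp
qed

text \<open>If the conclusion fails, the factor containing \<Lambda> is at most 2, and
  \<open>core_inequality\<close> becomes a comparison of powers of \<open>fact n\<close> with a
  power of \<open>Z\<close>, which \<open>n\<close> is chosen to violate.\<close>

lemma norm_\<Lambda>_lower:
  assumes \<delta>: "card (conj_tuples V) \<le> \<delta>" "\<delta> \<ge> 1" "2 * ((\<delta> - 1) * (M - M')) \<le> M'"
    and n: "4 * Z ^ (2 * \<delta>) \<le> fact n"
  shows "1 \<le> fact w * norm \<Lambda>"
proof (rule ccontr)
  assume "\<not> ?thesis"
  then have small: "fact w * norm \<Lambda> + 1 \<le> 2" by simp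
  define N where "N = (fact n :: real)"
  define p where "p = (\<delta> - 1) * (M - M')"
  have N: "N \<ge> 1" by (simp add: N_def)
  define Y where "Y = Z * N ^ (M - M')"
  have pos: "fact (Suc M') * (2 * (X / N) ^ M') \<ge> 0" using X1 N by simp
  have "fact (Suc M') * ((fact w + 1) * (X / N) ^ M') \<le> fact (Suc M') * ((2 * fact w) * (X / N) ^ M')"
    using X1 N fact_ge_1[of w, where ?'a = real]
    by (intro mult_left_mono mult_right_mono) auto
  also have "\<dots> = fact w * (fact (Suc M') * (2 * (X / N) ^ M'))" by (simp only: mult_ac)
  also have "\<dots> \<le> (real M ^ w * (real n + 1) ^ M * N ^ M) * (fact (Suc M') * (2 * (X / N) ^ M'))"
    using fact_w_le pos unfolding N_def by (rule mult_right_mono)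
  also have "N ^ M = N ^ (M - M') * N ^ M'"
    using M'1 by (simp add: power_add[symmetric])
  also have "(real M ^ w * (real n + 1) ^ M * (N ^ (M - M') * N ^ M')) * (fact (Suc M') * (2 * (X / N) ^ M')) = Y"
    using N by (simp add: Y_def Z_def power_divide mult_ac del: fact_Suc)
  finally have Y: "fact (Suc M') * ((fact w + 1) * (X / N) ^ M') \<le> Y" .
  have Y1: "1 \<le> Y" unfolding Y_def using Z1 N mult_mono[of 1 Z 1 "N ^ (M - M')"] by simp
  have "1 \<le> Y ^ (\<delta> - 1) * (fact (Suc M') * ((fact w * norm \<Lambda> + 1) * (X / N) ^ M'))"
    using core_inequality[OF \<delta>(1) Y[unfolded N_def] Y1] by (simp only: N_def)
  also have "\<dots> \<le> Y ^ (\<delta> - 1) * (fact (Suc M') * (2 * (X / N) ^ M'))"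
    using small Y1 X1 N by (intro mult_left_mono mult_right_mono) auto
  also have "fact (Suc M') * (2 * (X / N) ^ M') = (2 * fact (Suc M') * X ^ M') / N ^ M'"
    by (simp add: power_divide del: fact_Suc)
  also have "Y ^ (\<delta> - 1) * \<dots> \<le> Y ^ (\<delta> - 1) * (Z / N ^ M')"
  proof (intro mult_left_mono divide_right_mono)
    have "2 * fact (Suc M') * X ^ M' * 1 \<le> Z"
      unfolding Z_def using X1 M'1 mult_mono[of 1 "real M ^ w" 1 "(real n + 1) ^ M"]
      by (intro mult_left_mono) auto
    then show "2 * fact (Suc M') * X ^ M' \<le> Z" by simp
  qed (use Y1 N in auto)
  also have "\<dots> = Z ^ \<delta> * N ^ p / N ^ M'"
    using \<delta>(2) by (cases \<delta>) (simp_all add: Y_def p_def power_mult_distrib power_mult[symmetric] mult_ac)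
  finally have "N ^ M' \<le> Z ^ \<delta> * N ^ p"
    using N by (simp add: divide_simps)
  \<comment> \<open>Squaring doubles \<open>p\<close>, and 2 p \<le> M' allows one copy of N^M' to
    be cancelled.\<close>
  then have "(N ^ M') ^ 2 \<le> (Z ^ \<delta> * N ^ p) ^ 2"
    using N by (intro power_mono) auto
  also have "\<dots> = Z ^ (2 * \<delta>) * N ^ (2 * p)"
    by (simp add: power_mult_distrib power_mult[symmetric] mult_ac)
  also have "\<dots> \<le> Z ^ (2 * \<delta>) * N ^ M'"
    using \<delta>(3) N Z1 by (intro mult_left_mono power_increasing) (auto simp: p_def)
  finally have "N ^ M' \<le> Z ^ (2 * \<delta>)"
    using N by (simp add: power2_eq_square)
  moreover have "N ^ 1 \<le> N ^ M'" using M'1 N by (intro power_increasing) auto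
  moreover have "Z ^ (2 * \<delta>) \<ge> 1" using Z1 by simp
  ultimately show False using n by (simp add: N_def)
qed

text \<open>The product of the bases \<open>4 * M\<close>, \<open>2 * M\<close> and
  \<open>q * (m * A * exp G) * (2 * G)\<close> that bound the three parts of
  \<open>Z\<close>.\<close>

definition B where "B = 16 * real M ^ 2 * (real q * (m * A * exp G) * G)"

lemma B16: "B \<ge> 16"
proof -
  have "16 * 1 ^ 2 * (1 * (1 * 1 * 1) * 1) \<le> B"
    unfolding B_def using M'1 q m A G1 by (intro mult_mono power_mono) auto
  then show ?thesis by simp
qed

lemma Z_le: "Z \<le> B ^ (w * M)"
proof -
  have M1: "M \<ge> 1" using M'1 by linarith
  have w1: "w \<ge> 1" "n + 1 \<le> w" using M1 mult_le_mono2[OF M1, of "n + 1"] by (simp_all add: w_def)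
  have wM: "w \<le> w * M" "M \<le> w * M" using M1 w1 by auto
  define H where "H = m * A * exp G"
  have H1: "H \<ge> 1"
  proof -
    have "1 * 1 * 1 \<le> H" unfolding H_def using m A G1 by (intro mult_mono) auto
    then show ?thesis by simp
  qed
  have "fact (Suc M') \<le> real (M + 1) ^ M"
  proof -
    have "fact (Suc M') \<le> (fact (Suc M) :: real)" using M'1 by (intro fact_mono) auto
    also have "\<dots> \<le> real (M + 1) ^ M"
    proof -
      have "fact (Suc k) \<le> (k + 1) ^ k" for k :: nat
      proof (induction k)
        case (Suc k)
        have "fact (Suc (Suc k)) = Suc (Suc k) * fact (Suc k)" by simp
        also have "\<dots> \<le> Suc (Suc k) * (k + 1) ^ k" using Suc by (intro mult_le_mono2)
        also have "\<dots> \<le> Suc (Suc k) * (k + 2) ^ k" by (intro mult_le_mono2 power_mono) auto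
        finally show ?case by simp
      qed simp
      from this[of M] have "real (fact (Suc M)) \<le> real ((M + 1) ^ M)" by (simp only: of_nat_le_iff)
      then show ?thesis by (simp only: of_nat_fact of_nat_power)
    qed
    finally show ?thesis .
  qed
  also have "\<dots> \<le> (2 * real M) ^ M" using M1 by (intro power_mono) auto
  finally have "fact (Suc M') \<le> (2 * real M) ^ M" .
  moreover have "(2 :: real) ^ 1 \<le> 2 ^ M" using M1 by (intro power_increasing) auto
  ultimately have "2 ^ 1 * fact (Suc M') \<le> 2 ^ M * (2 * real M) ^ M"
    by (intro mult_mono) simp_all
  also have "\<dots> = (2 * (2 * real M)) ^ M" by (rule power_mult_distrib[symmetric])
  finally have "2 * fact (Suc M') \<le> (4 * real M) ^ M" by simp
  also have "\<dots> \<le> (4 * real M) ^ (w * M)" using M1 wM by (intro power_increasing) auto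
  finally have 1: "2 * fact (Suc M') \<le> (4 * real M) ^ (w * M)" .
  define u where "u = real q * H * (2 * G)"
  have "X \<le> real q ^ w * (H ^ w * (2 * G) ^ w)"
    unfolding X_def H_def[symmetric] using H1 G1 q w1 self_le_power[of H w]
    by (intro mult_left_mono mult_right_mono) auto
  also have "\<dots> = u ^ w" by (simp add: u_def power_mult_distrib)
  finally have X: "X \<le> u ^ w" .
  have u1: "u \<ge> 1"
  proof -
    have "1 * 1 * (1 * 1) \<le> u" unfolding u_def using H1 G1 q by (intro mult_mono) auto
    then show ?thesis by simp
  qed
  have "X ^ M' \<le> X ^ M" using X1 M'1 by (intro power_increasing) auto
  also have "\<dots> \<le> (u ^ w) ^ M" using X X1 by (intro power_mono) auto
  finally have 2: "X ^ M' \<le> u ^ (w * M)" by (simp add: power_mult)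
  have "real n + 1 \<le> 2 ^ (n + 1)"
    using of_nat_less_two_power[of "n + 1", where ?'a = real] by simp
  then have "(real n + 1) ^ M \<le> (2 ^ (n + 1)) ^ M" by (intro power_mono) auto
  also have "\<dots> = 2 ^ w" by (simp only: power_mult[symmetric] w_def)
  also have "\<dots> \<le> 2 ^ (w * M)" using wM by (intro power_increasing) auto
  finally have "real M ^ w * (real n + 1) ^ M \<le> real M ^ (w * M) * 2 ^ (w * M)"
    using M1 wM by (intro mult_mono power_increasing) auto
  then have 3: "real M ^ w * (real n + 1) ^ M \<le> (2 * real M) ^ (w * M)"
    by (simp add: power_mult_distrib mult.commute)
  have "Z \<le> (4 * real M) ^ (w * M) * u ^ (w * M) * (2 * real M) ^ (w * M)"
    unfolding Z_def using 1 2 3 X1 u1 by (intro mult_mono) (auto simp del: fact_Suc)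
  also have "\<dots> = ((4 * real M) * u * (2 * real M)) ^ (w * M)"
    by (simp only: power_mult_distrib)
  also have "(4 * real M) * u * (2 * real M) = B"
    unfolding B_def u_def H_def[symmetric] by (simp add: power2_eq_square)
  finally show ?thesis .
qed

text \<open>The hypothesis says B^E \<le> n/e; taking n-th powers gives B^(E n) \<le> (n/e)^n \<le>
  n!.\<close>

lemma norm_\<Lambda>_lower_of_exp:
  assumes \<delta>: "card (conj_tuples V) \<le> \<delta>" "\<delta> \<ge> 1" "2 * ((\<delta> - 1) * (M - M')) \<le> M'"
    and n: "exp (1 + 5 * real \<delta> * real M ^ 2 * ln B) \<le> real n"
  shows "1 \<le> fact w * norm \<Lambda>"
proof (rule norm_\<Lambda>_lower[OF \<delta>])
  have M1: "M \<ge> 1" using M'1 by linarith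
  define E where "E = 5 * \<delta> * M ^ 2"
  have n1: "n \<ge> 1" using n by (cases n) auto
  \<comment> \<open>As w = (n+1) M, the left side is 2 \<delta> M^2 n + 2 \<delta> M^2 + 1; each of
    the last two terms is absorbed using n \<ge> 1, whence 5 = 2 + 2 + 1.\<close>
  have expo: "2 * \<delta> * (w * M) + 1 \<le> E * n"
  proof -
    have "\<delta> * M ^ 2 * 1 \<le> \<delta> * M ^ 2 * n" "1 \<le> \<delta> * M ^ 2" using n1 \<delta> M1 by auto
    moreover have "2 * \<delta> * (w * M) = 2 * (\<delta> * M ^ 2 * n) + 2 * (\<delta> * M ^ 2)"
      by (simp add: w_def power2_eq_square algebra_simps)
    ultimately show ?thesis unfolding E_def by linarith
  qed
  have "4 * Z ^ (2 * \<delta>) \<le> B * (B ^ (w * M)) ^ (2 * \<delta>)"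
    using B16 Z_le Z1 by (intro mult_mono power_mono) auto
  also have "\<dots> = B ^ (2 * \<delta> * (w * M) + 1)" by (simp add: power_mult[symmetric] mult.commute)
  also have "\<dots> \<le> B ^ (E * n)" using B16 expo by (intro power_increasing) auto
  also have "\<dots> = (B ^ E) ^ n" by (simp only: power_mult)
  also have "B ^ E = exp (real E * ln B)" using B16 by (simp add: exp_of_nat_mult)
  also have "\<dots> = exp (1 + 5 * real \<delta> * real M ^ 2 * ln B) * exp (- 1)"
    by (simp add: E_def exp_add[symmetric])
  also have "\<dots> ^ n \<le> (real n * exp (- 1)) ^ n"
    using n by (intro power_mono mult_right_mono) auto
  also have "\<dots> = real n ^ n * exp (- real n)"
    by (simp add: power_mult_distrib exp_of_nat_mult[symmetric])
  also have "\<dots> \<le> (fact n * exp (real n)) * exp (- real n)"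
    using power_le_fact_exp by (intro mult_right_mono) auto
  also have "\<dots> = fact n" by (simp add: exp_minus)
  finally show "4 * Z ^ (2 * \<delta>) \<le> fact n" .
qed

end

section \<open>The lower bound\<close>

lemma card_conj_tuples_le:
  assumes "finite V" "\<And>x. x \<in> V \<Longrightarrow> algebraic x" "\<And>x. x \<in> V \<Longrightarrow> alg_degree x \<le> d"
  shows "card (conj_tuples V) \<le> d ^ card V"
proof -
  have "card (conj_tuples V) = (\<Prod>x\<in>V. alg_degree x)"
    using assms by (simp add: conj_tuples_def card_PiE card_alg_conjs)
  also have "\<dots> \<le> (\<Prod>x\<in>V. d)" using assms by (intro prod_mono) auto
  finally show ?thesis by simp
qed

definition denom :: "complex set \<Rightarrow> nat" where
  "denom V = nat (\<Prod>x\<in>V. \<bar>lead_coeff (defining_poly x)\<bar>)"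

lemma denom_pos:
  assumes "\<And>x. x \<in> V \<Longrightarrow> algebraic x"
  shows "denom V \<ge> 1"
proof -
  have "(\<Prod>x\<in>V. \<bar>lead_coeff (defining_poly x)\<bar>) > 0"
    using assms defining_poly_nonzero by (intro prod_pos) auto
  then show ?thesis by (simp add: denom_def)
qed

lemma denom_le:
  assumes "\<And>x. x \<in> V \<Longrightarrow> real_of_int \<bar>lead_coeff (defining_poly x)\<bar> \<le> A"
  shows "real (denom V) \<le> A ^ card V"
proof -
  have "real (denom V) = (\<Prod>x\<in>V. real_of_int \<bar>lead_coeff (defining_poly x)\<bar>)"
    by (simp add: denom_def prod_nonneg)
  also have "\<dots> \<le> (\<Prod>x\<in>V. A)" using assms by (intro prod_mono) auto
  finally show ?thesis by simp
qed

lemma denom_int_fun: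
  assumes V: "finite V" and x: "x \<in> V"
  shows "(\<lambda>t. of_nat (denom V) * t x) \<in> int_funs V"
proof -
  define l where "l = lead_coeff (defining_poly x)"
  define r where "r = sgn l * (\<Prod>y\<in>V - {x}. \<bar>lead_coeff (defining_poly y)\<bar>)"
  have "int (denom V) = r * l"
  proof -
    have "int (denom V) = (\<Prod>y\<in>V. \<bar>lead_coeff (defining_poly y)\<bar>)"
      by (simp add: denom_def prod_nonneg)
    also have "\<dots> = \<bar>l\<bar> * (\<Prod>y\<in>V - {x}. \<bar>lead_coeff (defining_poly y)\<bar>)"
      unfolding l_def by (rule prod.remove[OF V x])
    also have "\<bar>l\<bar> = l * sgn l" by (rule abs_sgn)
    finally show ?thesis by (simp only: r_def mult_ac)
  qed
  then have "(of_nat (denom V) :: complex) = of_int r * of_int l"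
    by (metis of_int_mult of_int_of_nat_eq)
  then show ?thesis
    using int_funs_cmult[OF int_funs.var[OF x], of r] by (simp add: l_def mult.assoc)
qed

section \<open>Numerical estimates for the final bound\<close>

lemma ln_base_le:
  fixes M G A m q :: real
  assumes "M \<ge> 1" "A \<ge> 1" "m \<ge> 1" "q \<ge> 1" "m * A \<le> G" "ln q \<le> 2 * m * ln A"
  shows "ln (16 * M ^ 2 * (q * (m * A * exp G) * G)) \<le> 12 * G * M"
proof -
  have le: "ln x \<le> x" if "x \<ge> 1" for x :: real
    using ln_le_minus_one[of x] that by linarith
  have mG: "m \<le> G" "A \<le> G" "1 \<le> G"
  proof -
    have "m * 1 \<le> m * A" "1 * A \<le> m * A" using assms by (intro mult_mono; simp)+
    then show "m \<le> G" "A \<le> G" "1 \<le> G" using assms by linarith+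
  qed
  have "16 \<le> exp (4 :: real)"
    using power_mono[of 2 "exp (1 :: real)" 4] exp_ge_add_one_self[of "1 :: real"]
    by (simp add: exp_of_nat_mult[symmetric])
  then have ln16: "ln 16 \<le> (4 :: real)"
    by (subst exp_le_cancel_iff[symmetric]) simp
  have "2 * m * ln A \<le> 2 * m * A"
    using le[OF assms(2)] assms by (intro mult_left_mono) auto
  then have lnq: "ln q \<le> 2 * G" using assms by linarith
  have "ln (16 * M ^ 2 * (q * (m * A * exp G) * G)) =
      ln 16 + 2 * ln M + ln q + ln m + ln A + G + ln G"
    using assms mG by (simp add: ln_mult ln_realpow)
  \<comment> \<open>The factor \<open>exp G\<close> contributes \<open>G\<close> itself. The crude
    bound ln x \<le> x suffices for the others, since m, A and 1 are at most G.\<close>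
  also have "\<dots> \<le> 4 + 2 * M + 2 * G + G + G + G + G"
    using ln16 le[of M] le[of m] le[of A] le[of G] lnq assms mG by linarith
  also have "\<dots> \<le> 10 * G + 2 * M" using mG by linarith
  also have "\<dots> \<le> 10 * (G * M) + 2 * (G * M)"
    using mult_mono[of G G 1 M] mult_mono[of 1 G M M] assms mG by (intro add_mono mult_left_mono) auto
  finally show ?thesis by simp
qed

text \<open>Every factor is replaced by an exponential, and the exponents are compared through \<mu>
  \<ge> d h + 3 m.\<close>

lemma double_exp_bound:
  fixes m d \<delta> :: nat and h M K :: real
  assumes m: "m \<ge> 1" and d: "d \<ge> 1" and h: "h \<ge> 0" and \<delta>: "\<delta> \<ge> 1"
    and \<mu>: "\<mu> = real m * real d ^ (6 * m) * (2 * h / real d + 3)"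
    and M: "0 \<le> M" "M \<le> (17 * real \<delta> ^ 3) ^ m" and K: "0 \<le> K" "K \<le> 16 * real \<delta> ^ 3"
  shows "168 * real \<delta> * M ^ 3 * (real m * K * exp (real d * h)) \<le> 12 * exp (6 * real \<delta> ^ 2 * \<mu>)"
proof -
  have two_half: "(5 / 2 :: real) \<le> exp 1" using exp_lower_Taylor_quadratic[of "1::real"] by simp
  have e_pow: "(5 / 2 :: real) ^ r \<le> exp (real r)" for r
    using power_mono[OF two_half, of r] by (simp add: exp_of_nat_mult[symmetric])
  \<comment> \<open>Below, 168 * 16 = 2688 = 12 * 224.\<close>
  have e6: "224 \<le> exp (6 :: real)" using e_pow[of 6] by (simp add: power_divide)
  have e10: "17 ^ 3 \<le> exp (10 :: real)" using e_pow[of 10] by (simp add: power_divide)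
  \<comment> \<open>Chosen so that \<delta> \<le> 1 + x is the inequality (\<delta>-1)^2 \<ge> 0.
    Powers of \<delta> then cost exponents linear in \<delta>^2, as 6 \<delta>^2 \<mu>
    permits.\<close>
  define x where "x = (real \<delta> ^ 2 - 1) / 2"
  have x0: "x \<ge> 0" using \<delta> by (simp add: x_def)
  have \<delta>x: "real \<delta> \<le> exp x"
  proof -
    have "0 \<le> (real \<delta> - 1) ^ 2" by simp
    then have "real \<delta> \<le> 1 + x" by (simp add: x_def power2_eq_square field_simps)
    then show ?thesis using exp_ge_add_one_self[of x] by linarith
  qed
  have mx: "real m \<le> exp (real m - 1)" using exp_ge_add_one_self[of "real m - 1"] by simp
  have "M ^ 3 \<le> ((17 * real \<delta> ^ 3) ^ m) ^ 3" using M by (intro power_mono)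
  also have "\<dots> = ((17 * real \<delta> ^ 3) ^ 3) ^ m" by (metis power_mult mult.commute)
  also have "\<dots> = (17 ^ 3 * real \<delta> ^ 9) ^ m"
  proof -
    have "(17 * real \<delta> ^ 3) ^ 3 = 17 ^ 3 * real \<delta> ^ 9"
      by (simp add: power_mult_distrib power_mult[symmetric])
    then show ?thesis by (simp only:)
  qed
  also have "\<dots> \<le> (exp 10 * exp x ^ 9) ^ m"
    using e10 \<delta>x by (intro power_mono mult_mono) auto
  also have "\<dots> = exp (real m * (10 + 9 * x))"
  proof -
    have "exp 10 * exp x ^ 9 = exp (10 + 9 * x)"
      by (simp add: exp_add exp_of_nat_mult[symmetric])
    then show ?thesis by (simp only: exp_of_nat_mult)
  qed
  finally have M3: "M ^ 3 \<le> exp (real m * (10 + 9 * x))" .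
  have "168 * real \<delta> * M ^ 3 * (real m * K * exp (real d * h)) \<le>
      168 * real \<delta> * exp (real m * (10 + 9 * x)) * (exp (real m - 1) * (16 * real \<delta> ^ 3) * exp (real d * h))"
    using M3 mx K by (intro mult_mono mult_left_mono) auto
  also have "\<dots> = 2688 * real \<delta> ^ 4 * (exp (real m * (10 + 9 * x)) * exp (real m - 1) * exp (real d * h))"
    by (simp add: power4_eq_xxxx power3_eq_cube)
  also have "\<dots> \<le> (12 * exp 6) * exp x ^ 4 * (exp (real m * (10 + 9 * x)) * exp (real m - 1) * exp (real d * h))"
    using e6 \<delta>x by (intro mult_right_mono mult_mono power_mono) auto
  also have "exp x ^ 4 = exp (4 * x)" by (simp add: exp_of_nat_mult[symmetric])
  also have "(12 * exp 6) * exp (4 * x) * (exp (real m * (10 + 9 * x)) * exp (real m - 1) * exp (real d * h)) =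
      12 * exp (6 + 4 * x + (real m * (10 + 9 * x) + (real m - 1) + real d * h))"
    by (simp only: exp_add mult_ac)
  also have "\<dots> \<le> 12 * exp (6 * real \<delta> ^ 2 * \<mu>)"
  proof -
    have mx: "1 * x \<le> real m * x" using m x0 by (intro mult_right_mono) auto
    have "6 + 4 * x + real m * (10 + 9 * x) + (real m - 1) \<le> real m * (18 * real \<delta> ^ 2)"
    proof -
      have eq: "real m * (18 * real \<delta> ^ 2) = 36 * (real m * x) + 18 * real m"
        by (simp add: x_def field_simps)
      have "real m * (10 + 9 * x) = 10 * real m + 9 * (real m * x)" by (simp add: algebra_simps)
      moreover have "0 \<le> real m * x" using x0 by simp
      moreover have "1 \<le> real m" using m by simp
      ultimately show ?thesis unfolding eq using mx by linarith
    qed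
    moreover have "real d * h + real m * (18 * real \<delta> ^ 2) \<le> 6 * real \<delta> ^ 2 * \<mu>"
    proof -
      have dp: "real d ^ 1 \<le> real d ^ (6 * m - 1)" "1 \<le> real d ^ (6 * m)"
        using d m by (intro power_increasing, auto)
      have split: "real d ^ (6 * m) = real d ^ (6 * m - 1) * real d"
      proof -
        have "6 * m = Suc (6 * m - 1)" using m by simp
        then show ?thesis by (metis power_Suc2)
      qed
      have \<mu>': "\<mu> = real m * (2 * (real d ^ (6 * m - 1) * h)) + 3 * real m * real d ^ (6 * m)"
      proof -
        have "a * (P * D) * (2 * h / D + 3) = a * (2 * (P * h)) + 3 * a * (P * D)"
          if "D > 0" for a P D :: real
          using that by (simp add: distrib_left mult_ac)
        then show ?thesis unfolding \<mu> split using d by simp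
      qed
      have "real d * h \<le> real d ^ (6 * m - 1) * h" using dp h by (intro mult_right_mono) auto
      moreover have "1 * (2 * (real d ^ (6 * m - 1) * h)) \<le> real m * (2 * (real d ^ (6 * m - 1) * h))"
        using m h by (intro mult_right_mono) auto
      moreover have "3 * real m * 1 \<le> 3 * real m * real d ^ (6 * m)"
        using dp by (intro mult_left_mono) auto
      moreover have dh: "0 \<le> real d * h" using h by simp
      ultimately have "real d * h + 3 * real m \<le> \<mu>" unfolding \<mu>' by linarith
      then have "6 * real \<delta> ^ 2 * (real d * h + 3 * real m) \<le> 6 * real \<delta> ^ 2 * \<mu>"
        by (intro mult_left_mono) auto
      moreover have "1 * (real d * h) \<le> (6 * real \<delta> ^ 2) * (real d * h)"
      proof (rule mult_right_mono[OF _ dh])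
        have "1 \<le> real \<delta> ^ 2" using \<delta> by (intro one_le_power) simp
        then show "1 \<le> 6 * real \<delta> ^ 2" by simp
      qed
      ultimately show ?thesis by (simp add: algebra_simps)
    qed
    ultimately show ?thesis by simp
  qed
  finally show ?thesis .
qed

text \<open>Since \<open>n\<close> is an exponential rounded up, the square is one too; its exponent
  is at most 14 \<delta> M^2 b, and b \<le> 12 G M gives 168 = 14 * 12.\<close>

lemma square_le_double_exp:
  fixes M G \<delta> b n :: real
  assumes M: "M \<ge> 1" and \<delta>: "\<delta> \<ge> 1" and b: "2 \<le> b" "b \<le> 12 * G * M"
    and n: "n \<le> exp (1 + 5 * \<delta> * M ^ 2 * b) + 1" "n \<ge> 0"
  shows "((n + 1) * M) ^ 2 \<le> exp (168 * \<delta> * M ^ 3 * G)"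
proof -
  define E where "E = 1 + 5 * \<delta> * M ^ 2 * b"
  have M2: "M \<le> \<delta> * M ^ 2" "1 \<le> \<delta> * M ^ 2"
  proof -
    have "1 * (1 * M) \<le> \<delta> * (M * M)" using M \<delta> by (intro mult_mono) auto
    then show "M \<le> \<delta> * M ^ 2" by (simp add: power2_eq_square)
    then show "1 \<le> \<delta> * M ^ 2" using M by linarith
  qed
  have b2: "(\<delta> * M ^ 2) * 2 \<le> (\<delta> * M ^ 2) * b" using b M2 by (intro mult_left_mono) auto
  have E0: "E \<ge> 0" using b2 M2 by (simp add: E_def mult.assoc)
  have e2: "2 \<le> exp (1 :: real)" using exp_ge_add_one_self[of "1::real"] by simp
  have "n + 1 \<le> exp E + 2" using n by (simp add: E_def)
  also have "\<dots> \<le> exp E * exp 1 ^ 2"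
  proof -
    have "exp E * 4 \<le> exp E * exp 1 ^ 2" using power_mono[OF e2, of 2] by (intro mult_left_mono) auto
    moreover have "1 \<le> exp E" using E0 by simp
    ultimately show ?thesis by linarith
  qed
  also have "\<dots> = exp (E + 2)" by (simp add: exp_add exp_of_nat_mult[symmetric])
  finally have n1: "n + 1 \<le> exp (E + 2)" .
  have "M \<le> exp (M - 1)" using exp_ge_add_one_self[of "M - 1"] by simp
  then have "(n + 1) * M \<le> exp (E + 2) * exp (M - 1)" using n1 n M by (intro mult_mono) auto
  then have "((n + 1) * M) ^ 2 \<le> (exp (E + 2) * exp (M - 1)) ^ 2"
    using n M by (intro power_mono) auto
  also have "\<dots> = exp (2 * (E + M + 1))"
    by (simp add: exp_add[symmetric] exp_of_nat_mult[symmetric] algebra_simps)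
  also have "\<dots> \<le> exp (168 * \<delta> * M ^ 3 * G)"
  proof -
    have "2 * (E + M + 1) = 10 * (\<delta> * M ^ 2 * b) + 2 * M + 4"
      by (simp add: E_def algebra_simps)
    also have "\<dots> \<le> 14 * ((\<delta> * M ^ 2) * b)" using b2 M2 by linarith
    also have "\<dots> \<le> 14 * ((\<delta> * M ^ 2) * (12 * G * M))"
      using b M2 by (intro mult_left_mono) auto
    also have "\<dots> = 168 * \<delta> * M ^ 3 * G" by (simp add: power2_eq_square power3_eq_cube)
    finally show ?thesis by simp
  qed
  finally show ?thesis .
qed

text \<open>The first conjunct is stated separately because \<open>ln\<close> returns a default
  value at 0, where the inequality would not express a lower bound.\<close>

theorem theorem1p2:
  fixes m d \<delta> :: nat
    and \<alpha> \<beta> :: "nat \<Rightarrow> complex"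
    and h \<mu> r r' r'' R :: real
  assumes "m \<ge> 1"
    and "\<And>i. i \<in> {1..m} \<Longrightarrow> algebraic (\<alpha> i)"
    and "inj_on \<alpha> {1..m}"
    and "\<And>i. i \<in> {1..m} \<Longrightarrow> algebraic (\<beta> i)"
    and "\<And>i. i \<in> {1..m} \<Longrightarrow> \<beta> i \<noteq> 0"
    and "d = Max (alg_degree ` (\<alpha> ` {1..m} \<union> \<beta> ` {1..m}))"
    and "h = Max (weil_height ` (\<alpha> ` {1..m} \<union> \<beta> ` {1..m}))"
    and "\<delta> = d ^ (2 * m)"
    and "\<mu> = real m * real d ^ (6 * m) * (2 * h / real d + 3)"
    and "r = 82 * (9/2) ^ \<delta> * real \<delta> ^ (3 * \<delta> + 2)"
    and "r' = 12 * (9/2) ^ \<delta> * real \<delta> ^ (3 * \<delta> + 2)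
            + 16 * (1 + 6 * real \<delta> ^ 2) * (9/2) ^ \<delta> * real \<delta> ^ (3 * \<delta>) * ln (9 * real \<delta> ^ 3)
            + 80 * (9/2) ^ \<delta> * real \<delta> ^ (3 * \<delta> + 4) * (1 + 6 * real \<delta>) * \<mu>"
    and "r'' = 16 * (1 + 6 * real \<delta> ^ 2) * (9/2) ^ \<delta> * real \<delta> ^ (3 * \<delta>)"
    and "R = r' * real m ^ \<delta> * exp (6 * real \<delta> ^ 2 * \<mu>)
           + r'' * real m ^ \<delta> * exp (6 * real \<delta> ^ 2 * \<mu>) * (ln (real m) + 6 * real \<delta> * \<mu>)
           + 72 * exp (2 * real \<delta> * \<mu>)"
  shows "(\<Sum>i=1..m. \<beta> i * exp (\<alpha> i)) \<noteq> 0 \<and>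
         ln (norm (\<Sum>i=1..m. \<beta> i * exp (\<alpha> i)))
           \<ge> - exp (8 * real \<delta> * \<mu>)
             - r * real m ^ \<delta> * exp (6 * real \<delta> ^ 2 * \<mu>)
               * (real m * h + 39/164 * \<mu> + exp R)"
proof -
  define V where "V = \<alpha> ` {1..m} \<union> \<beta> ` {1..m}"
  have V: "finite V" "V \<noteq> {}" "\<And>x. x \<in> V \<Longrightarrow> algebraic x"
    using assms(1,2,4) by (auto simp: V_def)
  have deg: "alg_degree x \<le> d" and ht: "weil_height x \<le> h" if "x \<in> V" for x
    using that V unfolding assms(6,7) V_def[symmetric] by auto
  obtain x0 where x0: "x0 \<in> V" using V(2) by blast
  have d1: "d \<ge> 1" using alg_degree_pos[OF V(3)[OF x0]] deg[OF x0] by linarith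
  have h0: "h \<ge> 0" using weil_height_nonneg[OF V(3) deg ht] ht x0 by (meson order_trans)
  have \<delta>1: "\<delta> \<ge> 1" using d1 by (simp add: assms(8))
  have \<mu>0: "\<mu> \<ge> 0" using h0 by (simp add: assms(9))
  have m_\<delta>: "\<delta> = 1 \<or> \<delta> \<ge> 2 \<and> m \<le> \<delta>"
  proof (cases "d = 1")
    case False
    then have "2 ^ (2 * m) \<le> \<delta>" unfolding assms(8) using d1 by (intro power_mono) auto
    moreover have "2 * m < 2 ^ (2 * m)" by (rule less_exp)
    ultimately show ?thesis using assms(1) by linarith
  qed (simp add: assms(8))
  \<comment> \<open>At most 2m numbers with at most \<open>d\<close> conjugates each: this is the
    origin of \<delta> = d^(2m).\<close>
  have "card V \<le> card (\<alpha> ` {1..m}) + card (\<beta> ` {1..m})"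
    unfolding V_def by (rule card_Un_le)
  also have "\<dots> \<le> m + m" using card_image_le[of "{1..m}"] by (intro add_mono) fastforce+
  finally have cardV: "card V \<le> 2 * m" by simp
  have card_T: "card (conj_tuples V) \<le> \<delta>"
    using card_conj_tuples_le[OF V(1,3) deg] power_increasing[OF cardV d1]
    unfolding assms(8) by (meson order_trans)
  define A where "A = exp (real d * h)"
  have A1: "A \<ge> 1" using h0 by (simp add: A_def)
  have A: "norm (t x) \<le> A" if "t \<in> conj_tuples V" "x \<in> V" for t x
    unfolding A_def using that by (intro conj_le_height[OF V(3) deg ht]) (auto simp: conj_tuples_def)
  have q1: "denom V \<ge> 1" using V(3) by (rule denom_pos)
  have "real (denom V) \<le> A ^ card V"
    unfolding A_def by (rule denom_le) (rule lead_coeff_le_height[OF V(3) deg ht])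
  also have "\<dots> \<le> A ^ (2 * m)" using cardV A1 by (rule power_increasing)
  finally have "ln (real (denom V)) \<le> ln (A ^ (2 * m))" using q1 A1 by simp
  then have lnq: "ln (real (denom V)) \<le> 2 * real m * ln A" using A1 by (simp add: ln_realpow)
  have "\<exists>k. Suc k \<le> 16 * \<delta> ^ 3 \<and> card (grid m \<alpha> (Suc k)) \<le> (17 * \<delta> ^ 3) ^ m \<and>
      2 * ((\<delta> - 1) * (card (grid m \<alpha> (Suc k)) - card (grid m \<alpha> k))) \<le> card (grid m \<alpha> k)"
  proof (rule exists_slow_growth)
    show "1 \<le> card (grid m \<alpha> 0)"
      using grid_nonempty finite_grid by (simp add: Suc_le_eq card_gt_0_iff)
    show "card (grid m \<alpha> k) \<le> card (grid m \<alpha> (Suc k))" for k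
      by (intro card_mono finite_grid grid_mono) simp
  qed (use assms(1) m_\<delta> card_grid_le in auto)
  then obtain k where kk: "Suc k \<le> 16 * \<delta> ^ 3" "card (grid m \<alpha> (Suc k)) \<le> (17 * \<delta> ^ 3) ^ m"
    "2 * ((\<delta> - 1) * (card (grid m \<alpha> (Suc k)) - card (grid m \<alpha> k))) \<le> card (grid m \<alpha> k)"
    by blast
  have "\<exists>e. \<gamma> = (\<Sum>i=1..m. of_nat (e i) * \<alpha> i) \<and> (\<forall>i\<in>{1..m}. e i \<le> Suc k)"
    if "\<gamma> \<in> grid m \<alpha> (Suc k)" for \<gamma>
    using that unfolding grid_def by (fastforce simp: PiE_iff)
  then obtain \<rho> where \<rho>: "\<gamma> = (\<Sum>i=1..m. of_nat (\<rho> \<gamma> i) * \<alpha> i)" "\<forall>i\<in>{1..m}. \<rho> \<gamma> i \<le> Suc k"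
    if "\<gamma> \<in> grid m \<alpha> (Suc k)" for \<gamma>
    by metis
  define Mr where "Mr = real (card (grid m \<alpha> (Suc k)))"
  define Gr where "Gr = real m * real (Suc k) * A"
  define Br where "Br = 16 * Mr ^ 2 * (real (denom V) * (m * A * exp Gr) * Gr)"
  \<comment> \<open>The least admissible \<open>n\<close>; the rounding error of at most 1 is
    allowed for in \<open>square_le_double_exp\<close>.\<close>
  define n where "n = nat \<lceil>exp (1 + 5 * real \<delta> * Mr ^ 2 * ln Br)\<rceil>"
  interpret exp_sum_approx V "grid m \<alpha> (Suc k)" "grid m \<alpha> k" m "Suc k" n "denom V" \<alpha> \<beta> \<rho> A
    by unfold_locales
      (use V assms(1-5) finite_grid grid_mono[of k "Suc k" m \<alpha>] grid_nonempty grid_step \<rho> q1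
        denom_int_fun[OF V(1)] A1 A in \<open>auto simp: V_def\<close>)
  have Mr: "Mr = real M" "Gr = G" "Br = B"
    by (simp_all add: Mr_def Gr_def Br_def M_def G_def B_def)
  have "1 \<le> fact w * norm \<Lambda>"
  proof (rule norm_\<Lambda>_lower_of_exp[OF card_T \<delta>1])
    show "2 * ((\<delta> - 1) * (M - M')) \<le> M'" using kk(3) by (simp add: M_def M'_def)
    show "exp (1 + 5 * real \<delta> * (real M)\<^sup>2 * ln B) \<le> real n"
      unfolding n_def Mr[symmetric] by (rule real_nat_ceiling_ge)
  qed
  moreover have "(fact w :: real) > 0" by simp
  ultimately have \<Lambda>_pos: "norm \<Lambda> > 0" and \<Lambda>_ge: "1 / fact w \<le> norm \<Lambda>"
    by (auto simp: divide_simps mult.commute zero_less_mult_iff dest: less_le_trans[OF zero_less_one])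
  have M1: "real M \<ge> 1" using M'1 by simp
  \<comment> \<open>This loses little: \<open>w\<close> itself is doubly exponentially bounded, and
    the square merely doubles the exponent.\<close>
  have "ln (fact w) \<le> real w ^ 2"
  proof -
    have "w \<ge> 1" using M'1 by (auto simp: w_def)
    have "(fact w :: real) \<le> real (w ^ w)" by (rule fact_le_power)
    then have "ln (fact w) \<le> ln (real w ^ w)" using \<open>w \<ge> 1\<close> by (subst ln_le_cancel_iff) simp_all
    also have "\<dots> = real w * ln (real w)" using \<open>w \<ge> 1\<close> by (simp add: ln_realpow)
    also have "\<dots> \<le> real w * real w"
      using \<open>w \<ge> 1\<close> ln_le_minus_one[of "real w"] by (intro mult_left_mono) auto
    finally show ?thesis by (simp add: power2_eq_square)
  qed
  also have "real w = (real n + 1) * real M" by (simp add: w_def algebra_simps)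
  also have "\<dots> ^ 2 \<le> exp (168 * real \<delta> * real M ^ 3 * G)"
  proof (rule square_le_double_exp)
    show "real n \<le> exp (1 + 5 * real \<delta> * (real M)\<^sup>2 * ln B) + 1"
    proof -
      have "real (nat \<lceil>exp x\<rceil>) \<le> exp x + 1" for x :: real
        using of_int_ceiling_le_add_one[of "exp x"] by (simp add: less_imp_le)
      then show ?thesis unfolding n_def Mr[symmetric] .
    qed
    have "exp 2 \<le> B"
    proof -
      have "exp 1 \<le> (4 :: real)" using exp_le by linarith
      then have "exp 1 ^ 2 \<le> (4 :: real) ^ 2" by (intro power_mono) auto
      then show ?thesis using B16 by (simp add: exp_of_nat_mult[symmetric])
    qed
    then show "2 \<le> ln B" using B16 by (subst exp_le_cancel_iff[symmetric]) simp
    show "ln B \<le> 12 * G * real M"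
      unfolding B_def
    proof (rule ln_base_le)
      show "real m * A \<le> G"
        unfolding G_def using A1 by (intro mult_right_mono) (auto simp: algebra_simps)
    qed (use M1 A1 assms(1) q1 lnq in auto)
  qed (use M1 \<delta>1 in auto)
  also have "168 * real \<delta> * real M ^ 3 * G \<le> 12 * exp (6 * real \<delta> ^ 2 * \<mu>)"
    unfolding G_def unfolding A_def
  proof (rule double_exp_bound[OF assms(1) d1 h0 \<delta>1 assms(9)])
    have "real M \<le> real ((17 * \<delta> ^ 3) ^ m)" using kk(2) by (simp only: M_def of_nat_le_iff)
    then show "real M \<le> (17 * real \<delta> ^ 3) ^ m" by simp
    have "real (Suc k) \<le> real (16 * \<delta> ^ 3)" using kk(1) by (simp only: of_nat_le_iff)
    then show "real (Suc k) \<le> 16 * real \<delta> ^ 3" by simp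
  qed auto
  \<comment> \<open>All terms of \<open>R\<close> are nonnegative, and the first summand of r' is at
    least 12, matching the constant of \<open>double_exp_bound\<close>.\<close>
  also have "\<dots> \<le> R"
  proof -
    have "1 * 1 \<le> (9 / 2 :: real) ^ \<delta> * real \<delta> ^ (3 * \<delta> + 2)"
      using \<delta>1 by (intro mult_mono one_le_power) auto
    then have ge1: "1 \<le> (9 / 2 :: real) ^ \<delta> * real \<delta> ^ (3 * \<delta> + 2)" "1 \<le> real m ^ \<delta>"
      using assms(1) by simp_all
    have "1 \<le> real \<delta> ^ 3" using \<delta>1 by (intro one_le_power) simp
    then have ln0: "0 \<le> ln (9 * real \<delta> ^ 3)" "0 \<le> ln (real m)"
      using assms(1) by (intro ln_ge_zero; simp)+
    have r'': "0 \<le> r''" unfolding assms(12) by simp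
    have "12 * ((9 / 2) ^ \<delta> * real \<delta> ^ (3 * \<delta> + 2)) \<le> r'"
      unfolding assms(11) using ln0(1) \<mu>0 by (simp add: mult.assoc)
    then have "12 \<le> r'" using ge1(1) by linarith
    then have "12 * 1 \<le> r' * real m ^ \<delta>" using ge1(2) by (intro mult_mono) auto
    then have "12 * 1 * exp (6 * real \<delta> ^ 2 * \<mu>) \<le> r' * real m ^ \<delta> * exp (6 * real \<delta> ^ 2 * \<mu>)"
      by (intro mult_right_mono) auto
    moreover have "0 \<le> r'' * real m ^ \<delta> * exp (6 * real \<delta> ^ 2 * \<mu>) * (ln (real m) + 6 * real \<delta> * \<mu>)"
      using r'' ln0 \<mu>0 by simp
    moreover have "0 < 72 * exp (2 * real \<delta> * \<mu>)" by simp
    ultimately show ?thesis unfolding assms(13) by linarith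
  qed
  finally have fact_le: "ln (fact w) \<le> exp R" by simp
  have "- exp (8 * real \<delta> * \<mu>)
       - r * real m ^ \<delta> * exp (6 * real \<delta> ^ 2 * \<mu>) * (real m * h + 39/164 * \<mu> + exp R) \<le> - exp R"
  proof -
    have "1 \<le> r * real m ^ \<delta> * exp (6 * real \<delta> ^ 2 * \<mu>)"
    proof -
      have "1 * 1 * 1 * 1 * 1 \<le> 82 * (9/2) ^ \<delta> * real \<delta> ^ (3 * \<delta> + 2) * real m ^ \<delta> * exp (6 * real \<delta> ^ 2 * \<mu>)"
        using \<delta>1 \<mu>0 assms(1) by (intro mult_mono one_le_power) auto
      then show ?thesis by (simp add: assms(10))
    qed
    then have "1 * exp R \<le> r * real m ^ \<delta> * exp (6 * real \<delta> ^ 2 * \<mu>) * (real m * h + 39/164 * \<mu> + exp R)"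
      using h0 \<mu>0 by (intro mult_mono) auto
    then show ?thesis using exp_gt_zero[of "8 * real \<delta> * \<mu>"] by linarith
  qed
  also have "\<dots> \<le> - ln (fact w)" using fact_le by simp
  also have "\<dots> = ln (1 / fact w)" by (simp add: ln_div)
  also have "\<dots> \<le> ln (norm \<Lambda>)" using \<Lambda>_ge \<Lambda>_pos by (subst ln_le_cancel_iff) simp_all
  finally show ?thesis using \<Lambda>_pos by (auto simp: \<Lambda>_def)
qed

end
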